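(* Let $G$ be an $(n,d,\lambda)$-graph with $\lambda<d/500$ and $n$ sufficiently large. Let $l\ge 2000\lambda n/d$ and let $\mathcal{F}$ be an $\left(\frac{l}{100\log n},l,500\lambda\right)$-good collection of paths on $V(G)$. Then the graph $G\cup\mathcal{F}$ (obtained from $G$ by adding all edges of the paths and cycles of $\mathcal{F}$) contains a Hamilton cycle.
   Context: An $(n,d,\lambda)$-graph is an $n$-vertex $d$-regular graph whose second largest eigenvalue in absolute value is at most $\lambda$. Given a path $P$ and vertex-disjoint cycles $\mathcal{C}=\{C_1,\dots,C_l\}$, $P$ connects $\mathcal{C}$ if there are edges $e_i\in E(C_i)$ such that $P$ contains every $e_i$ and is disjoint from all other vertices of each $C_i$. Then for each $i$, $x^P_i,y^P_i$ denote the vertices of $C_i$ not incident to $e_i$ that are closest to $e_i$ along $C_i$ on either side (so $x^P_i=y^P_i$ if $C_i$ is a triangle); the flexible set is $V_{P,\mathcal{C}}=\{x^P_i,y^P_i:1\le i\le l\}$. A collection of vertex-disjoint paths on $V(G)$ is $(r,l,\delta)$-good (with respect to $G$) if it consists of at most $r$ paths $P_1,\dots,P_{r'}$ such that: (1) $P_1$ connects a collection $\mathcal{C}$ of $l$ vertex-disjoint cycles which are disjoint from $P_2,\dots,P_{r'}$, and these paths together with $\mathcal{C}$ cover all of $V(G)$; (2) $V_{P_1,\mathcal{C}}$ induces in $G$ a graph of minimum degree at least $\delta$; (3) each endpoint of each path $P_1,\dots,P_{r'}$ has at least $\delta$ neighbours in $G$ inside $V_{P_1,\mathcal{C}}$.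 Such a collection is regarded as including the cycles of $\mathcal{C}$. *)

theory Defs
  imports "Jordan_Normal_Form.Char_Poly"
begin

definition graph_on :: "nat \<Rightarrow> (nat \<Rightarrow> nat \<Rightarrow> bool) \<Rightarrow> bool" where
  "graph_on n E \<longleftrightarrow> (\<forall>u v. E u v \<longrightarrow> u < n \<and> v < n) \<and> (\<forall>u v. E u v \<longrightarrow> E v u) \<and> (\<forall>u. \<not> E u u)"

definition regular :: "nat \<Rightarrow> (nat \<Rightarrow> nat \<Rightarrow> bool) \<Rightarrow> nat \<Rightarrow> bool" where
  "regular n E d \<longleftrightarrow> (\<forall>v<n. card {u. u < n \<and> E v u} = d)"

definition adj_matrix :: "nat \<Rightarrow> (nat \<Rightarrow> nat \<Rightarrow> bool) \<Rightarrow> real mat" where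
  "adj_matrix n E = mat n n (\<lambda>(i,j). if E i j then 1 else 0)"

text \<open>Eigenvalues with multiplicity = roots of the characteristic polynomial
  (all real, since the adjacency matrix is symmetric). The (n,d,lambda) condition:
  after removing one copy of the top eigenvalue d, every eigenvalue has absolute value
  at most lambda, i.e. the second largest eigenvalue in absolute value is at most lambda.\<close>

definition ndl_graph :: "nat \<Rightarrow> nat \<Rightarrow> real \<Rightarrow> (nat \<Rightarrow> nat \<Rightarrow> bool) \<Rightarrow> bool" where
  "ndl_graph n d lam E \<longleftrightarrow> graph_on n E \<and> regular n E d \<and>
     (\<forall>\<mu> \<in># proots (char_poly (adj_matrix n E)) - {# real d #}. \<bar>\<mu>\<bar> \<le> lam)"

definition is_path :: "nat \<Rightarrow> nat list \<Rightarrow> bool" where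
  "is_path n ps \<longleftrightarrow> ps \<noteq> [] \<and> distinct ps \<and> set ps \<subseteq> {0..<n}"

definition is_cycle :: "nat \<Rightarrow> nat list \<Rightarrow> bool" where
  "is_cycle n cs \<longleftrightarrow> length cs \<ge> 3 \<and> distinct cs \<and> set cs \<subseteq> {0..<n}"

definition path_edge :: "nat list \<Rightarrow> nat \<Rightarrow> nat \<Rightarrow> bool" where
  "path_edge ps u v \<longleftrightarrow> (\<exists>i. Suc i < length ps \<and> {u, v} = {ps ! i, ps ! Suc i})"

definition cycle_edge :: "nat list \<Rightarrow> nat \<Rightarrow> nat \<Rightarrow> bool" where
  "cycle_edge cs u v \<longleftrightarrow> (\<exists>i < length cs. {u, v} = {cs ! i, cs ! ((i + 1) mod length cs)})"

text \<open>The chosen edge e of cycle cs is {cs!j, cs!(j+1 mod k)}; the flexible vertices are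
  the closest vertices of cs not incident to e on either side.\<close>

definition flex_x :: "nat list \<Rightarrow> nat \<Rightarrow> nat" where
  "flex_x cs j = cs ! ((j + length cs - 1) mod length cs)"

definition flex_y :: "nat list \<Rightarrow> nat \<Rightarrow> nat" where
  "flex_y cs j = cs ! ((j + 2) mod length cs)"

definition connects_via :: "nat list \<Rightarrow> nat list list \<Rightarrow> nat list \<Rightarrow> bool" where
  "connects_via P Cs js \<longleftrightarrow> length js = length Cs \<and>
     (\<forall>i < length Cs. js ! i < length (Cs ! i) \<and>
        path_edge P (Cs ! i ! (js ! i)) (Cs ! i ! ((js ! i + 1) mod length (Cs ! i))) \<and>
        set P \<inter> set (Cs ! i) = {Cs ! i ! (js ! i), Cs ! i ! ((js ! i + 1) mod length (Cs ! i))})"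

definition flex_set :: "nat list list \<Rightarrow> nat list \<Rightarrow> nat set" where
  "flex_set Cs js = (\<Union>i < length Cs. {flex_x (Cs ! i) (js ! i), flex_y (Cs ! i) (js ! i)})"

definition pairwise_disjoint_lists :: "nat list list \<Rightarrow> bool" where
  "pairwise_disjoint_lists xs \<longleftrightarrow>
     (\<forall>i < length xs. \<forall>j < length xs. i \<noteq> j \<longrightarrow> set (xs ! i) \<inter> set (xs ! j) = {})"

definition good_collection ::
  "nat \<Rightarrow> (nat \<Rightarrow> nat \<Rightarrow> bool) \<Rightarrow> real \<Rightarrow> nat \<Rightarrow> real \<Rightarrow> nat list list \<Rightarrow> nat list list \<Rightarrow> bool" where
  "good_collection n E r l \<delta> Ps Cs \<longleftrightarrow>
     Ps \<noteq> [] \<and> real (length Ps) \<le> r \<and> length Cs = l \<and>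
     (\<forall>P \<in> set Ps. is_path n P) \<and> pairwise_disjoint_lists Ps \<and>
     (\<forall>C \<in> set Cs. is_cycle n C) \<and> pairwise_disjoint_lists Cs \<and>
     (\<forall>C \<in> set Cs. \<forall>P \<in> set (tl Ps). set C \<inter> set P = {}) \<and>
     (\<Union>P \<in> set Ps. set P) \<union> (\<Union>C \<in> set Cs. set C) = {0..<n} \<and>
     (\<exists>js. connects_via (hd Ps) Cs js \<and>
        (\<forall>v \<in> flex_set Cs js. real (card {u \<in> flex_set Cs js. E v u}) \<ge> \<delta>) \<and>
        (\<forall>P \<in> set Ps. \<forall>v \<in> {hd P, last P}. real (card {u \<in> flex_set Cs js. E v u}) \<ge> \<delta>))"

definition union_graph :: "(nat \<Rightarrow> nat \<Rightarrow> bool) \<Rightarrow> nat list list \<Rightarrow> nat list list \<Rightarrow> nat \<Rightarrow> nat \<Rightarrow> bool" where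
  "union_graph E Ps Cs u v \<longleftrightarrow> E u v \<or> (\<exists>P \<in> set Ps. path_edge P u v) \<or> (\<exists>C \<in> set Cs. cycle_edge C u v)"

definition hamilton_cycle :: "nat \<Rightarrow> (nat \<Rightarrow> nat \<Rightarrow> bool) \<Rightarrow> nat list \<Rightarrow> bool" where
  "hamilton_cycle n H hs \<longleftrightarrow> length hs \<ge> 3 \<and> distinct hs \<and> set hs = {0..<n} \<and>
     (\<forall>i < length hs. H (hs ! i) (hs ! ((i + 1) mod length hs)))"

end

theory Submission
  imports Defs "HOL-Analysis.Function_Topology" "HOL-Analysis.L2_Norm"
begin

text \<open>A cycle \<open>C\<^sub>i\<close> with its chosen edge \<open>a\<^sub>i b\<^sub>i\<close> on \<open>P\<^sub>1\<close> leaves a path \<open>Q\<^sub>i\<close> whose ends are the two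
  flexible vertices. Each \<open>Q\<^sub>i\<close> may either be absorbed into \<open>P\<^sub>1\<close> between \<open>a\<^sub>i\<close> and \<open>b\<^sub>i\<close>, or be
  traversed separately, entering at one flexible vertex and leaving at the other. So it suffices to
  link the end of every \<open>P\<^sub>j\<close> to the start of the cyclically next path by walks that alternate between
  edges of \<open>G\<close> and traversals of pairwise different \<open>Q\<^sub>i\<close>; all other \<open>Q\<^sub>i\<close> are absorbed.

  By the expander mixing lemma and the minimum degree \<open>500\<lambda>\<close>, sets of at most \<open>2m\<close> vertices, with
  \<open>m\<close> about \<open>\<lambda>n/d\<close>, see at least twice as many cycles, and sets of at least \<open>m\<close> vertices see almost all
  cycles and are joined by an edge. Hence binary trees of traversals can be grown one vertex at a time
  by the Friedman--Pippenger argument. For each link one grows a tree with at least \<open>m\<close> leaves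
  from both terminals, joins two leaves by an edge, and gives everything but the two branches back, so
  a link costs only \<open>O(log n)\<close> cycles and there is room for all \<open>l/(100 log n)\<close> of them.

  The spectral bound behind the mixing lemma comes from a maximiser of \<open>|Af|\<close> on the unit sphere
  orthogonal to the constants: it yields an eigenvector orthogonal to the constants, whose eigenvalue
  stays a root after one factor \<open>x - d\<close> is removed from the characteristic polynomial.\<close>

section \<open>The expander mixing lemma\<close>

text \<open>Vectors are functions on all of \<open>nat\<close> of which only the values below
  \<open>n\<close> are read. No type has to carry the dimension, and the product topology on
  \<open>nat \<Rightarrow> real\<close> is at hand for compactness.\<close>

definition dot :: "nat \<Rightarrow> (nat \<Rightarrow> real) \<Rightarrow> (nat \<Rightarrow> real) \<Rightarrow> real" where
  "dot n f g = (\<Sum>i<n. f i * g i)"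

definition app :: "nat \<Rightarrow> (nat \<Rightarrow> nat \<Rightarrow> real) \<Rightarrow> (nat \<Rightarrow> real) \<Rightarrow> nat \<Rightarrow> real" where
  "app n a f i = (\<Sum>j<n. a i j * f j)"

lemma dot_commute: "dot n f g = dot n g f"
  by (simp add: dot_def mult.commute)

lemma dot_add_scale_left: "dot n (\<lambda>i. f i + c * g i) h = dot n f h + c * dot n g h"
  by (simp add: dot_def algebra_simps sum.distrib sum_distrib_left)

lemma dot_add_scale_right: "dot n h (\<lambda>i. f i + c * g i) = dot n h f + c * dot n h g"
  by (simp add: dot_def algebra_simps sum.distrib sum_distrib_left)

lemma dot_scale_left: "dot n (\<lambda>i. c * g i) h = c * dot n g h"
  by (simp add: dot_def algebra_simps sum_distrib_left)

lemma dot_scale_right: "dot n h (\<lambda>i. c * g i) = c * dot n h g"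
  by (simp add: dot_def algebra_simps sum_distrib_left)

lemma dot_self_nonneg: "0 \<le> dot n f f"
  by (simp add: dot_def sum_nonneg)

lemma dot_self_eq_0: "dot n f f = 0 \<longleftrightarrow> (\<forall>i<n. f i = 0)"
  by (auto simp: dot_def sum_nonneg_eq_0_iff)

lemma dot_cong: "(\<And>i. i < n \<Longrightarrow> f i = f' i) \<Longrightarrow> (\<And>i. i < n \<Longrightarrow> g i = g' i) \<Longrightarrow> dot n f g = dot n f' g'"
  by (simp add: dot_def)

lemma app_add_scale: "app n a (\<lambda>i. f i + c * g i) = (\<lambda>i. app n a f i + c * app n a g i)"
  by (simp add: app_def fun_eq_iff algebra_simps sum.distrib sum_distrib_left)

lemma app_scale: "app n a (\<lambda>i. c * g i) = (\<lambda>i. c * app n a g i)"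
  by (simp add: app_def fun_eq_iff algebra_simps sum_distrib_left)

lemma app_cong: "(\<And>i. i < n \<Longrightarrow> f i = g i) \<Longrightarrow> app n a f = app n a g"
  by (simp add: app_def fun_eq_iff)

lemma dot_app:
  assumes "\<And>i j. a i j = a j i"
  shows "dot n (app n a f) g = dot n f (app n a g)"
proof -
  have "dot n (app n a f) g = (\<Sum>i<n. \<Sum>j<n. a i j * f j * g i)"
    by (simp add: dot_def app_def sum_distrib_right)
  also have "\<dots> = (\<Sum>j<n. \<Sum>i<n. a i j * f j * g i)" by (rule sum.swap)
  also have "\<dots> = dot n f (app n a g)"
    using assms by (simp add: dot_def app_def sum_distrib_left algebra_simps)
  finally show ?thesis .
qed

lemma Cauchy_Schwarz_dot: "dot n f g \<le> sqrt (dot n f f) * sqrt (dot n g g)"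
proof -
  have "dot n f g \<le> (\<Sum>i<n. \<bar>f i\<bar> * \<bar>g i\<bar>)"
    unfolding dot_def by (intro sum_mono) (metis abs_ge_self abs_mult)
  also have "\<dots> \<le> L2_set f {..<n} * L2_set g {..<n}" by (rule L2_set_mult_ineq)
  finally show ?thesis by (simp add: dot_def L2_set_def power2_eq_square)
qed

section \<open>An extremal eigenvector orthogonal to the constants\<close>

text \<open>By Tychonoff: the set is closed in a product of intervals \<open>{-1..1}\<close> below
  \<open>n\<close> and singletons \<open>{0}\<close> from \<open>n\<close> on. Pinning the
  coordinates from \<open>n\<close> on to 0 is what allows compactness in
  \<open>nat \<Rightarrow> real\<close>.\<close>

lemma compact_unit_sphere_sum_zero:
  "compact {f. (\<forall>i\<ge>n. f i = 0) \<and> (\<Sum>i<n. f i) = 0 \<and> dot n f f = (1::real)}" (is "compact ?K")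
proof -
  let ?B = "PiE UNIV (\<lambda>i. if i < n then {-1..1} else {0::real})"
  have "compactin (product_topology (\<lambda>_. euclidean) UNIV) ?B"
    by (subst compactin_PiE) auto
  hence B: "compact ?B" by (simp add: euclidean_product_topology)
  have c: "continuous_on UNIV (\<lambda>f::nat \<Rightarrow> real. f i)" for i by simp
  have "closed {f. (\<Sum>i<n. f i) = (0::real)}"
    by (intro closed_Collect_eq continuous_intros c)
  moreover have "closed {f. dot n f f = 1}"
    unfolding dot_def by (intro closed_Collect_eq continuous_intros c)
  ultimately have "compact (?B \<inter> ({f. (\<Sum>i<n. f i) = 0} \<inter> {f. dot n f f = 1}))"
    using B by blast
  moreover have "?K = ?B \<inter> ({f. (\<Sum>i<n. f i) = 0} \<inter> {f. dot n f f = 1})"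
  proof -
    have "\<bar>f i\<bar> \<le> 1" if "dot n f f = 1" "i < n" for f i
    proof -
      have "f i * f i \<le> (\<Sum>i<n. f i * f i)" using that(2) by (intro member_le_sum) auto
      hence "(f i)\<^sup>2 \<le> 1" using that by (simp add: dot_def power2_eq_square)
      thus ?thesis by (simp add: abs_square_le_1)
    qed
    thus ?thesis by (fastforce simp: PiE_iff abs_le_iff split: if_splits)
  qed
  ultimately show ?thesis by simp
qed

text \<open>First-variation principle: for a small step \<open>e\<close> of sign opposite to
  \<open>b\<close> the linear term outweighs the quadratic one. The step
  \<open>- b / (\<bar>c\<bar> + 1)\<close> is small enough for every \<open>c\<close>.\<close>

lemma nonneg_quadratic_linear_coeff_0:
  fixes b c :: real
  assumes "\<And>e. 0 \<le> 2 * e * b + e\<^sup>2 * c"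
  shows "b = 0"
proof (rule ccontr)
  assume b: "b \<noteq> 0"
  define e where "e = - b / (\<bar>c\<bar> + 1)"
  have p: "\<bar>c\<bar> + 1 > 0" by simp
  have "2 * e * b + e\<^sup>2 * c = b\<^sup>2 * (c - 2 * (\<bar>c\<bar> + 1)) / (\<bar>c\<bar> + 1)\<^sup>2"
    using p unfolding e_def by (simp add: divide_simps power2_eq_square) (simp add: algebra_simps)
  also have "\<dots> < 0" using b p by (intro divide_neg_pos mult_pos_neg) auto
  finally show False using assms[of e] by simp
qed

text \<open>Symmetry and equal row sums make the sum-zero space invariant. A maximiser
  \<open>f\<close> of \<open>|Af|\<close> on its unit sphere satisfies
  \<open>A(Af) = \<mu>^2 f\<close> by first variation. Since
  \<open>(A - \<mu>)(A + \<mu>)f = 0\<close>, either \<open>f\<close> is an eigenvector for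
  \<open>-\<mu>\<close> or \<open>Af + \<mu>f\<close> is one for \<open>\<mu>\<close>; the bound
  involves only \<open>\<mu>^2\<close> and so fits both cases.\<close>

lemma extremal_eigenvector_orthogonal_to_ones:
  fixes a :: "nat \<Rightarrow> nat \<Rightarrow> real"
  assumes sym: "\<And>i j. a i j = a j i" and rows: "\<And>i. i < n \<Longrightarrow> (\<Sum>j<n. a i j) = d" and n: "n \<ge> 2"
  obtains g \<mu> where "(\<Sum>i<n. g i) = 0" "\<exists>i<n. g i \<noteq> 0" "\<And>i. i < n \<Longrightarrow> app n a g i = \<mu> * g i"
    "\<And>f. (\<Sum>i<n. f i) = 0 \<Longrightarrow> dot n (app n a f) (app n a f) \<le> \<mu>\<^sup>2 * dot n f f"
proof -
  let ?K = "{f. (\<forall>i\<ge>n. f i = 0) \<and> (\<Sum>i<n. f i) = 0 \<and> dot n f f = (1::real)}"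
  let ?\<Phi> = "\<lambda>f. dot n (app n a f) (app n a f)"
  have sum_app: "(\<Sum>i<n. app n a f i) = d * (\<Sum>i<n. f i)" for f
  proof -
    have "(\<Sum>i<n. app n a f i) = dot n (app n a f) (\<lambda>_. 1)" by (simp add: dot_def)
    also have "\<dots> = dot n f (app n a (\<lambda>_. 1))" by (rule dot_app[OF sym])
    also have "\<dots> = d * (\<Sum>i<n. f i)"
      by (simp add: dot_def app_def rows sum_distrib_left mult.commute)
    finally show ?thesis .
  qed
  have c: "continuous_on UNIV (\<lambda>f::nat \<Rightarrow> real. f i)" for i by simp
  \<comment> \<open>Two opposite entries show that the sphere is nonempty; this uses
    \<open>n \<ge> 2\<close>.\<close>
  define f0 :: "nat \<Rightarrow> real" where "f0 = (\<lambda>i. if i = 0 then 1 / sqrt 2 else if i = 1 then - 1 / sqrt 2 else 0)"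
  have s2: "{..<n} = insert 0 (insert 1 {2..<n})" using n by auto
  have "f0 \<in> ?K" using n unfolding f0_def dot_def by (simp add: s2)
  hence ne: "?K \<noteq> {}" by blast
  have "continuous_on ?K ?\<Phi>"
    unfolding dot_def app_def
    by (intro continuous_intros continuous_on_subset[OF c]) auto
  from continuous_attains_sup[OF compact_unit_sphere_sum_zero ne this]
  obtain f where f: "f \<in> ?K" and fmax: "\<And>h. h \<in> ?K \<Longrightarrow> ?\<Phi> h \<le> ?\<Phi> f" by blast
  define \<mu> where "\<mu> = sqrt (?\<Phi> f)"
  have \<mu>2: "\<mu>\<^sup>2 = ?\<Phi> f" by (simp add: \<mu>_def dot_self_nonneg)
  have bound: "?\<Phi> h \<le> \<mu>\<^sup>2 * dot n h h" if h: "(\<Sum>i<n. h i) = 0" for h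
  proof (cases "dot n h h = 0")
    case True
    hence "\<forall>i<n. h i = 0" by (simp add: dot_self_eq_0)
    hence "app n a h = (\<lambda>_. 0)" by (simp add: app_def fun_eq_iff)
    thus ?thesis by (simp add: True) (simp add: dot_def)
  next
    case False
    define s where "s = sqrt (dot n h h)"
    have s: "s > 0" using False dot_self_nonneg[of n h] by (simp add: s_def)
    have s2: "s * s = dot n h h" by (simp add: s_def dot_self_nonneg)
    \<comment> \<open>The normalised \<open>h\<close>, cut off at \<open>n\<close> because members
      of \<open>?K\<close> vanish from there on.\<close>
    define k where "k = (\<lambda>i. if i < n then (1/s) * h i else 0)"
    have "app n a k = app n a (\<lambda>i. (1/s) * h i)" by (rule app_cong) (simp add: k_def)
    hence ak: "app n a k = (\<lambda>i. (1/s) * app n a h i)" by (simp only: app_scale)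
    have "dot n k k = dot n (\<lambda>i. (1/s) * h i) (\<lambda>i. (1/s) * h i)" by (rule dot_cong) (auto simp: k_def)
    also have "\<dots> = (1/s) * ((1/s) * dot n h h)"
      by (simp only: dot_scale_left dot_scale_right)
    also have "\<dots> = 1" using s by (simp add: s2[symmetric])
    finally have "dot n k k = 1" .
    moreover have "(\<Sum>i<n. k i) = 0"
      using h by (simp add: k_def flip: sum_divide_distrib)
    ultimately have "k \<in> ?K" by (simp add: k_def)
    from fmax[OF this] have "(1/s) * ((1/s) * ?\<Phi> h) \<le> \<mu>\<^sup>2"
      unfolding ak \<mu>2 by (simp only: dot_scale_left dot_scale_right)
    hence "?\<Phi> h \<le> \<mu>\<^sup>2 * (s * s)" using s by (simp add: field_simps)
    thus ?thesis by (simp add: s2)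
  qed
  have ff: "dot n f f = 1" and f_sum: "(\<Sum>i<n. f i) = 0" using f by auto
  have orth: "dot n f (app n a (app n a h)) = \<mu>\<^sup>2 * dot n f h" if h: "(\<Sum>i<n. h i) = 0" for h
  proof -
    define b where "b = \<mu>\<^sup>2 * dot n f h - dot n (app n a f) (app n a h)"
    define c where "c = \<mu>\<^sup>2 * dot n h h - ?\<Phi> h"
    have "0 \<le> 2 * e * b + e\<^sup>2 * c" for e
    proof -
      let ?h = "\<lambda>i. f i + e * h i"
      have "(\<Sum>i<n. ?h i) = 0" using h f_sum by (simp add: sum.distrib flip: sum_distrib_left)
      from bound[OF this] have "?\<Phi> f + 2 * e * dot n (app n a f) (app n a h) + e\<^sup>2 * ?\<Phi> h
         \<le> \<mu>\<^sup>2 * (dot n f f + 2 * e * dot n f h + e\<^sup>2 * dot n h h)"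
        unfolding app_add_scale dot_add_scale_left dot_add_scale_right
        by (simp add: dot_commute[of n h f] dot_commute[of n "app n a h" "app n a f"] power2_eq_square algebra_simps)
      thus ?thesis unfolding b_def c_def using ff \<mu>2 by (simp add: algebra_simps)
    qed
    from nonneg_quadratic_linear_coeff_0[OF this] have "b = 0" .
    thus ?thesis by (simp add: b_def dot_app[OF sym])
  qed
  \<comment> \<open>The defect of the desired equation has sum 0, so it can serve as its own test
    vector in \<open>orth\<close>, which gives it norm 0.\<close>
  let ?w = "\<lambda>i. app n a (app n a f) i + (- \<mu>\<^sup>2) * f i"
  have w0: "(\<Sum>i<n. ?w i) = 0"
    by (simp only: sum.distrib sum_app f_sum sum_distrib_left[symmetric] mult_zero_right add_0)
  have "dot n ?w ?w = 0"
    using orth[OF w0] by (simp only: dot_add_scale_left dot_app[OF sym])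
  hence AA: "app n a (app n a f) i = \<mu>\<^sup>2 * f i" if "i < n" for i
    using that by (auto simp: dot_self_eq_0)
  have f_ne: "\<exists>i<n. f i \<noteq> 0" using ff dot_self_eq_0[of n f] by auto
  show ?thesis
  proof (cases "\<forall>i<n. app n a f i + \<mu> * f i = 0")
    case True
    show ?thesis
      by (rule that[of f "-\<mu>"]) (use f_sum f_ne True bound in \<open>auto simp: add_eq_0_iff\<close>)
  next
    case False
    let ?g = "\<lambda>i. app n a f i + \<mu> * f i"
    have "app n a ?g i = \<mu> * ?g i" if "i < n" for i
      unfolding app_add_scale using AA[OF that] by (simp add: power2_eq_square algebra_simps)
    moreover have "(\<Sum>i<n. ?g i) = 0"
      by (simp add: sum.distrib sum_app f_sum flip: sum_distrib_left)
    ultimately show ?thesis using False bound by (intro that[of ?g \<mu>]) auto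
  qed
qed


section \<open>Splitting one root off the characteristic polynomial\<close>

lemma prod_list_diag_mat_eq:
  fixes A :: "'a :: comm_ring_1 mat"
  assumes "A \<in> carrier_mat n n" "n > 0" "\<And>i. 0 < i \<Longrightarrow> i < n \<Longrightarrow> A $$ (i,i) = 1"
  shows "prod_list (diag_mat A) = A $$ (0,0)"
proof -
  have "prod_list (diag_mat A) = (\<Prod>i = 0..<n. A $$ (i,i))"
    using assms(1) by (simp add: prod_list_diag_prod)
  also have "{0..<n} = insert 0 {1..<n}" using assms(2) by auto
  also have "(\<Prod>i \<in> insert 0 {1..<n}. A $$ (i,i)) = A $$ (0,0)"
    using assms(3) by (subst prod.insert) auto
  finally show ?thesis .
qed

text \<open>Adding all rows of \<open>xI - A\<close> to the first makes that row constantly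
  \<open>x - c\<close>, and this factor can be pulled out, leaving a row of ones. As matrices this
  reads \<open>L * ?X = D * ?M\<close> with \<open>L\<close> unitriangular and \<open>D\<close>
  diagonal with entries \<open>x - c, 1, ..., 1\<close>.\<close>

lemma char_poly_constant_column_sums:
  fixes A :: "real mat"
  assumes A: "A \<in> carrier_mat n n" and n: "n > 0"
    and cols: "\<And>j. j < n \<Longrightarrow> (\<Sum>i<n. A $$ (i,j)) = c"
  shows "char_poly A = [:- c, 1:] *
    det (mat n n (\<lambda>(i,j). if i = 0 then 1 else char_poly_matrix A $$ (i,j)))"
proof -
  let ?X = "char_poly_matrix A"
  let ?M = "mat n n (\<lambda>(i,j). if i = 0 then 1 else ?X $$ (i,j))"
  define L :: "real poly mat" where "L = mat n n (\<lambda>(i,j). if i = 0 \<or> i = j then 1 else 0)"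
  define D where "D = mat n n (\<lambda>(i,j). if i = j then if i = 0 then [:- c, 1:] else 1 else 0)"
  have X: "?X \<in> carrier_mat n n" using A by simp
  have L: "L \<in> carrier_mat n n" and D: "D \<in> carrier_mat n n" and M: "?M \<in> carrier_mat n n"
    by (auto simp: L_def D_def)
  have entry: "?X $$ (i,j) = (if i = j then [:0,1:] else 0) + [:- (A $$ (i,j)):]" if "i < n" "j < n" for i j
    using A that by (auto simp: char_poly_matrix_def)
  have col: "(\<Sum>i<n. ?X $$ (i,j)) = [:- c, 1:]" if j: "j < n" for j
  proof -
    have "(\<Sum>i<n. ?X $$ (i,j)) = (\<Sum>i<n. if i = j then [:0,1:] else 0) + (\<Sum>i<n. [:- (A $$ (i,j)):])"
      unfolding sum.distrib[symmetric] by (intro sum.cong) (use j entry in auto)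
    also have "(\<Sum>i<n. [:- (A $$ (i,j)):]) = [:- (\<Sum>i<n. A $$ (i,j)):]"
      by (induction n) auto
    finally show ?thesis using j cols by simp
  qed
  have "L * ?X = D * ?M"
  proof (rule eq_matI)
    fix i j assume "i < dim_row (D * ?M)" "j < dim_col (D * ?M)"
    hence ij: "i < n" "j < n" using D by auto
    have "(L * ?X) $$ (i,j) = (\<Sum>k = 0..<n. L $$ (i,k) * ?X $$ (k,j))"
      using ij L X by (simp add: scalar_prod_def)
    also have "\<dots> = (\<Sum>k<n. if i = 0 \<or> i = k then ?X $$ (k,j) else 0)"
      unfolding atLeast0LessThan by (intro sum.cong) (use ij in \<open>auto simp: L_def\<close>)
    also have "\<dots> = (if i = 0 then [:- c, 1:] else ?X $$ (i,j))"
      using ij by (auto simp: col)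
    also have "\<dots> = (\<Sum>k<n. if k = i then (if i = 0 then [:- c, 1:] else 1) * ?M $$ (k,j) else 0)"
      using ij by auto
    also have "\<dots> = (\<Sum>k = 0..<n. D $$ (i,k) * ?M $$ (k,j))"
      unfolding atLeast0LessThan by (intro sum.cong) (use ij in \<open>auto simp: D_def\<close>)
    also have "\<dots> = (D * ?M) $$ (i,j)"
      using ij D M by (simp add: scalar_prod_def)
    finally show "(L * ?X) $$ (i,j) = (D * ?M) $$ (i,j)" .
  qed (use L D X in auto)
  hence "det L * det ?X = det D * det ?M"
    using det_mult[OF L X] det_mult[OF D M] by simp
  moreover have "det L = 1"
  proof -
    have "upper_triangular L" by (auto simp: L_def intro!: upper_triangularI)
    thus ?thesis
      using det_upper_triangular[OF _ L] prod_list_diag_mat_eq[OF L n] n by (simp add: L_def)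
  qed
  moreover have "det D = [:- c, 1:]"
  proof -
    have "upper_triangular D" by (auto simp: D_def intro!: upper_triangularI)
    thus ?thesis
      using det_upper_triangular[OF _ D] prod_list_diag_mat_eq[OF D n] n by (simp add: D_def)
  qed
  ultimately show ?thesis by (simp add: char_poly_def)
qed

text \<open>The eigenvector lies in the kernel of the cofactor matrix evaluated at
  \<open>\<mu>\<close>: its row of ones gives the sum of \<open>g\<close>, which is 0, and the other
  rows give the eigenvalue equation. So \<open>\<mu>\<close> is a root of the cofactor, and it
  survives the removal of one copy of \<open>c\<close> even if \<open>\<mu> = c\<close>.\<close>

lemma eigenvalue_orthogonal_to_ones_in_proots:
  fixes A :: "real mat"
  assumes A: "A \<in> carrier_mat n n" and n: "n > 0"
    and cols: "\<And>j. j < n \<Longrightarrow> (\<Sum>i<n. A $$ (i,j)) = c"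
    and g0: "(\<Sum>i<n. g i) = 0" and g: "k < n" "g k \<noteq> 0"
    and eig: "\<And>i. i < n \<Longrightarrow> (\<Sum>j<n. A $$ (i,j) * g j) = \<mu> * g i"
  shows "\<mu> \<in># proots (char_poly A) - {# c #}"
proof -
  let ?X = "char_poly_matrix A"
  let ?M = "mat n n (\<lambda>(i,j). if i = 0 then 1 else ?X $$ (i,j))"
  let ?h = "\<lambda>p. poly p \<mu>"
  have h: "comm_ring_hom ?h" by unfold_locales auto
  have entry: "?X $$ (i,j) = (if i = j then [:0,1:] else 0) + [:- (A $$ (i,j)):]" if "i < n" "j < n" for i j
    using A that by (auto simp: char_poly_matrix_def)
  have Mh: "map_mat ?h ?M \<in> carrier_mat n n" by simp
  have "map_mat ?h ?M *\<^sub>v vec n g = 0\<^sub>v n"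
  proof (rule eq_vecI)
    fix i assume "i < dim_vec (0\<^sub>v n :: real vec)"
    hence i: "i < n" by simp
    have "(map_mat ?h ?M *\<^sub>v vec n g) $ i = (\<Sum>j<n. map_mat ?h ?M $$ (i,j) * g j)"
      using i by (simp add: scalar_prod_def atLeast0LessThan)
    also have "\<dots> = 0"
    proof (cases "i = 0")
      case True
      thus ?thesis using i g0 by simp
    next
      case False
      have "(\<Sum>j<n. map_mat ?h ?M $$ (i,j) * g j) = (\<Sum>j<n. (if j = i then \<mu> * g j else 0) - A $$ (i,j) * g j)"
        using i False by (intro sum.cong) (auto simp: entry algebra_simps)
      thus ?thesis using i eig[OF i] by (simp add: sum_subtractf)
    qed
    finally show "(map_mat ?h ?M *\<^sub>v vec n g) $ i = 0\<^sub>v n $ i" using i by simp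
  qed simp
  moreover have "vec n g \<noteq> 0\<^sub>v n" 
  proof
    assume "vec n g = 0\<^sub>v n"
    hence "vec n g $ k = 0\<^sub>v n $ k" by (rule arg_cong)
    thus False using g by simp
  qed
  ultimately have "det (map_mat ?h ?M) = 0"
    unfolding det_0_iff_vec_prod_zero[OF Mh] by (intro exI[of _ "vec n g"]) auto
  hence root: "poly (det ?M) \<mu> = 0" using comm_ring_hom.hom_det[OF h, of ?M] by simp
  have cp: "char_poly A = [:- c, 1:] * det ?M"
    by (rule char_poly_constant_column_sums[OF A n cols])
  moreover have "char_poly A \<noteq> 0" using degree_monic_char_poly[OF A] n by force
  ultimately have ne: "det ?M \<noteq> 0" by auto
  have "proots [:- c, 1:] = {# c #}"
    by (simp add: proots_linear_factor)
  hence "proots (char_poly A) = {# c #} + proots (det ?M)"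
    unfolding cp using ne by (subst proots_mult) auto
  thus ?thesis using root ne by simp
qed

section \<open>From the spectral condition to edge counts\<close>

lemma ndl_graph_row_sum:
  assumes "ndl_graph n d lam E" "i < n"
  shows "(\<Sum>j<n. if E i j then 1 else 0) = real d"
proof -
  have "(\<Sum>j<n. if E i j then 1 else 0) = real (card {u \<in> {..<n}. E i u})"
    by (simp flip: sum.inter_filter)
  also have "{u \<in> {..<n}. E i u} = {u. u < n \<and> E i u}" by auto
  finally show ?thesis using assms by (simp add: ndl_graph_def regular_def)
qed

text \<open>The extremal eigenvalue on the sum-zero space is among those that the spectral condition
  bounds by \<open>lam\<close>. Its existence also forces \<open>lam\<close> to be
  nonnegative.\<close>

lemma ndl_graph_operator_bound:
  fixes E :: "nat \<Rightarrow> nat \<Rightarrow> bool"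
  defines "a \<equiv> \<lambda>i j. if E i j then 1 else 0"
  assumes G: "ndl_graph n d lam E" and n: "n \<ge> 2"
  shows "lam \<ge> 0"
    and "(\<Sum>i<n. f i) = 0 \<Longrightarrow> dot n (app n a f) (app n a f) \<le> lam\<^sup>2 * dot n f f"
proof -
  have E: "E u v = E v u" for u v using G by (auto simp: ndl_graph_def graph_on_def)
  have sym: "a i j = a j i" for i j by (auto simp: a_def E)
  have rows: "(\<Sum>j<n. a i j) = real d" if "i < n" for i
    unfolding a_def by (rule ndl_graph_row_sum[OF G that])
  obtain g \<mu> where g: "(\<Sum>i<n. g i) = 0" "\<exists>i<n. g i \<noteq> 0" "\<And>i. i < n \<Longrightarrow> app n a g i = \<mu> * g i"
    and bd: "\<And>f. (\<Sum>i<n. f i) = 0 \<Longrightarrow> dot n (app n a f) (app n a f) \<le> \<mu>\<^sup>2 * dot n f f"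
    using extremal_eigenvector_orthogonal_to_ones[where a = a and n = n, OF sym rows n] by blast
  from g(2) obtain k where k: "k < n" "g k \<noteq> 0" by blast
  have adj: "adj_matrix n E $$ (i,j) = a i j" if "i < n" "j < n" for i j
    using that by (simp add: adj_matrix_def a_def)
  have "\<mu> \<in># proots (char_poly (adj_matrix n E)) - {# real d #}"
  proof (rule eigenvalue_orthogonal_to_ones_in_proots[where n = n and g = g and k = k])
    show "(\<Sum>i<n. adj_matrix n E $$ (i,j)) = real d" if "j < n" for j
      using rows[OF that] that by (subst (asm) sym) (simp add: adj)
    show "(\<Sum>j<n. adj_matrix n E $$ (i,j) * g j) = \<mu> * g i" if "i < n" for i
      using g(3)[OF that] that by (simp add: adj app_def)
  qed (use n g k in \<open>auto simp: adj_matrix_def\<close>)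
  hence \<mu>: "\<bar>\<mu>\<bar> \<le> lam" using G by (simp add: ndl_graph_def)
  thus "lam \<ge> 0" by linarith
  assume "(\<Sum>i<n. f i) = 0"
  hence "dot n (app n a f) (app n a f) \<le> \<mu>\<^sup>2 * dot n f f" by (rule bd)
  also have "\<mu>\<^sup>2 \<le> lam\<^sup>2" using \<mu> by (simp add: abs_le_square_iff[symmetric])
  hence "\<mu>\<^sup>2 * dot n f f \<le> lam\<^sup>2 * dot n f f" by (intro mult_right_mono dot_self_nonneg)
  finally show "dot n (app n a f) (app n a f) \<le> lam\<^sup>2 * dot n f f" .
qed

text \<open>The adjacency form applied to the indicators minus their means is exactly the deviation
  from the expected edge count. Cauchy-Schwarz and the operator bound on the sum-zero space then
  apply.\<close>

lemma expander_mixing: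
  fixes E :: "nat \<Rightarrow> nat \<Rightarrow> bool"
  assumes G: "ndl_graph n d lam E" and n: "n \<ge> 2" and S: "S \<subseteq> {..<n}" and T: "T \<subseteq> {..<n}"
  shows "\<bar>(\<Sum>s\<in>S. real (card {t\<in>T. E s t})) - real d * real (card S) * real (card T) / real n\<bar>
     \<le> lam * sqrt (real (card S) * real (card T))"
proof -
  define a :: "nat \<Rightarrow> nat \<Rightarrow> real" where "a = (\<lambda>i j. if E i j then 1 else 0)"
  note bd = ndl_graph_operator_bound[OF G n, folded a_def]
  have E: "E u v = E v u" for u v using G by (auto simp: ndl_graph_def graph_on_def)
  have sym: "a i j = a j i" for i j by (auto simp: a_def E)
  have rows: "(\<Sum>j<n. a i j) = real d" if "i < n" for i
    unfolding a_def by (rule ndl_graph_row_sum[OF G that])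
  define ind :: "nat set \<Rightarrow> nat \<Rightarrow> real" where "ind = (\<lambda>U i. if i \<in> U then 1 else 0)"
  \<comment> \<open>The factor \<open>1\<close> keeps the shape \<open>f i + c * g i\<close> of the
    bilinearity lemmas, with a constant function as \<open>g\<close>.\<close>
  define dv where "dv = (\<lambda>U i. ind U i + (- real (card U) / real n) * 1)"
  have fin: "finite S" "finite T" using S T finite_subset by auto
  have ind_sum: "(\<Sum>i<n. ind U i * h i) = (\<Sum>i\<in>U. h i)" if "U \<subseteq> {..<n}" for U h
  proof -
    have "(\<Sum>i<n. ind U i * h i) = (\<Sum>i<n. if i \<in> U then h i else 0)"
      by (intro sum.cong) (auto simp: ind_def)
    also have "\<dots> = (\<Sum>i\<in>U. h i)" using that by (simp add: sum.If_cases Int_absorb1)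
    finally show ?thesis .
  qed
  have ind1: "dot n (ind U) (\<lambda>_. 1) = real (card U)" if "U \<subseteq> {..<n}" for U
    using ind_sum[OF that, of "\<lambda>_. 1"] by (simp add: dot_def)
  have one1: "dot n (\<lambda>_. 1) (\<lambda>_. 1) = real n" by (simp add: dot_def)
  have a1: "dot n f (app n a (\<lambda>_. 1)) = real d * dot n f (\<lambda>_. 1)" for f
    by (simp add: dot_def app_def rows sum_distrib_left mult.commute)
  have a1': "dot n (\<lambda>_. 1) (app n a f) = real d * dot n f (\<lambda>_. 1)" for f
    by (subst dot_app[OF sym, symmetric], subst dot_commute) (rule a1)
  have dv0: "(\<Sum>i<n. dv U i) = 0" if "U \<subseteq> {..<n}" for U
  proof -
    have "(\<Sum>i<n. dv U i) = (\<Sum>i<n. ind U i * 1) + (\<Sum>i<n. - real (card U) / real n)"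
      unfolding dv_def sum.distrib by simp
    also have "\<dots> = 0" using n unfolding ind_sum[OF that, of "\<lambda>_. 1"] by simp
    finally show ?thesis .
  qed
  have expand: "dot n (dv U) (dv V) = dot n (ind U) (ind V) + (- real (card V) / real n) * dot n (ind U) (\<lambda>_. 1)
      + (- real (card U) / real n) * (dot n (\<lambda>_. 1) (ind V) + (- real (card V) / real n) * dot n (\<lambda>_. 1) (\<lambda>_. 1))" for U V
    unfolding dv_def
    by (simp only: dot_add_scale_left[of n "ind U" "- real (card U) / real n" "\<lambda>_. 1"]
      dot_add_scale_right[of n _ "ind V" "- real (card V) / real n" "\<lambda>_. 1"])
  \<comment> \<open>The exact value is \<open>card U - (card U)^2 / n\<close>.\<close>
  have dvn: "dot n (dv U) (dv U) \<le> real (card U)" if U: "U \<subseteq> {..<n}" for U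
  proof -
    have "dot n (ind U) (ind U) = real (card U)"
      using ind_sum[OF U, of "ind U"] by (simp add: dot_def ind_def)
    thus ?thesis
      using n unfolding expand dot_commute[of n "\<lambda>_. 1" "ind U"]
      by (simp add: ind1[OF U] one1 field_simps)
  qed
  have "dot n (ind S) (app n a (ind T)) = (\<Sum>s\<in>S. \<Sum>t\<in>T. a s t)"
    using ind_sum[OF S, of "app n a (ind T)"] ind_sum[OF T]
    by (simp add: dot_def app_def mult.commute[of "a _ _"])
  also have "\<dots> = (\<Sum>s\<in>S. real (card {t\<in>T. E s t}))"
    using fin by (simp add: a_def flip: sum.inter_filter)
  finally have e: "dot n (ind S) (app n a (ind T)) = (\<Sum>s\<in>S. real (card {t\<in>T. E s t}))" .
  have "dot n (dv S) (app n a (dv T)) =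
      (\<Sum>s\<in>S. real (card {t\<in>T. E s t})) - real d * real (card S) * real (card T) / real n"
    unfolding dv_def app_add_scale[of n a "ind T" "- real (card T) / real n" "\<lambda>_. 1"]
      dot_add_scale_left[of n "ind S" "- real (card S) / real n" "\<lambda>_. 1"]
      dot_add_scale_right[of n _ "app n a (ind T)" "- real (card T) / real n" "app n a (\<lambda>_. 1)"]
    using n by (simp add: e a1 a1' ind1[OF S] ind1[OF T] one1 field_simps)
  moreover have "\<bar>dot n (dv S) (app n a (dv T))\<bar> \<le> lam * sqrt (real (card S) * real (card T))"
  proof -
    let ?x = "dv S" and ?y = "app n a (dv T)"
    have "dot n ?y ?y \<le> lam\<^sup>2 * dot n (dv T) (dv T)" by (rule bd(2)[OF dv0[OF T]])
    also have "\<dots> \<le> lam\<^sup>2 * real (card T)" by (intro mult_left_mono dvn[OF T]) simp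
    finally have y: "sqrt (dot n ?y ?y) \<le> lam * sqrt (real (card T))"
      using bd(1) by (metis real_sqrt_le_iff real_sqrt_mult real_sqrt_abs abs_of_nonneg)
    have x: "sqrt (dot n ?x ?x) \<le> sqrt (real (card S))" using dvn[OF S] by simp
    have "sqrt (dot n ?x ?x) * sqrt (dot n ?y ?y) \<le> sqrt (real (card S)) * (lam * sqrt (real (card T)))"
      by (intro mult_mono x y) (auto simp: dot_self_nonneg)
    hence xy: "sqrt (dot n ?x ?x) * sqrt (dot n ?y ?y) \<le> lam * sqrt (real (card S) * real (card T))"
      by (simp add: real_sqrt_mult mult_ac)
    have "dot n ?x ?y \<le> sqrt (dot n ?x ?x) * sqrt (dot n ?y ?y)" by (rule Cauchy_Schwarz_dot)
    moreover have "- dot n ?x ?y \<le> sqrt (dot n ?x ?x) * sqrt (dot n ?y ?y)"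
      using Cauchy_Schwarz_dot[of n "\<lambda>i. -1 * ?x i" ?y]
      by (simp only: dot_scale_left dot_scale_right) simp
    ultimately show ?thesis using xy by linarith
  qed
  ultimately show ?thesis by simp
qed

section \<open>Linking terminals through an expander of ports\<close>

text \<open>A pair \<open>(i, b)\<close> in \<open>qs\<close> stands for crossing the path left by
  cycle \<open>i\<close> from its end \<open>pv i b\<close> to its other end
  \<open>pv i (\<not> b)\<close>. Only the graph edges before, between and after the crossings are
  demanded.\<close>

definition linked :: "(nat \<Rightarrow> nat \<Rightarrow> bool) \<Rightarrow> (nat \<Rightarrow> bool \<Rightarrow> nat) \<Rightarrow> nat \<Rightarrow> (nat \<times> bool) list \<Rightarrow> nat \<Rightarrow> bool" where
  "linked E pv s qs t \<longleftrightarrow> qs \<noteq> [] \<and> E s (pv (fst (hd qs)) (snd (hd qs))) \<and>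
     successively (\<lambda>p q. E (pv (fst p) (\<not> snd p)) (pv (fst q) (snd q))) qs \<and>
     E (pv (fst (last qs)) (\<not> snd (last qs))) t"

text \<open>\<open>X\<close> holds ports and terminals, \<open>m\<close> separates small from large
  sets, and \<open>c\<close> caps the number of indices in use when another one is added. The factor
  2 in \<open>small_expand\<close> pays for binary branching. With \<open>c\<close> indices removed,
  \<open>large_expand\<close> still leaves more than \<open>4 * m\<close>, twice the largest size
  treated in \<open>small_expand\<close>. The two ports of one index may coincide, as happens for a
  triangle.\<close>

locale port_expander =
  fixes E :: "nat \<Rightarrow> nat \<Rightarrow> bool" and pv :: "nat \<Rightarrow> bool \<Rightarrow> nat" and X :: "nat set" and l m c :: nat
  assumes E_sym: "E u v \<Longrightarrow> E v u"
    and fin_X: "finite X"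
    and pv_in_X: "i < l \<Longrightarrow> pv i b \<in> X"
    and pv_eqD: "i < l \<Longrightarrow> j < l \<Longrightarrow> pv i b = pv j b' \<Longrightarrow> i = j"
    and m_pos: "m \<ge> 1"
    and small_expand: "S \<subseteq> X \<Longrightarrow> card S \<le> 2 * m \<Longrightarrow> 2 * card S \<le> card {i. i < l \<and> (\<exists>b. \<exists>s\<in>S. E s (pv i b))}"
    and large_expand: "S \<subseteq> X \<Longrightarrow> m \<le> card S \<Longrightarrow> 4 * m + c < card {i. i < l \<and> (\<exists>b. \<exists>s\<in>S. E s (pv i b))}"
    and joined: "S \<subseteq> X \<Longrightarrow> T \<subseteq> X \<Longrightarrow> m \<le> card S \<Longrightarrow> m \<le> card T \<Longrightarrow> \<exists>s\<in>S. \<exists>t\<in>T. E s t"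
begin

section \<open>Extendable forests and tight sets\<close>

text \<open>Neighbours are counted as indices rather than vertices, because each cycle can be
  crossed only once.\<close>

definition nbrs :: "nat set \<Rightarrow> nat set" where
  "nbrs S = {i. i < l \<and> (\<exists>b. \<exists>s\<in>S. E s (pv i b))}"

text \<open>An index \<open>i \<in> F\<close> is in use: it was entered at \<open>pv i (ent i)\<close> from the vertex \<open>par i\<close> and
  is left at \<open>pv i (\<not> ent i)\<close>. The last conjunct is the extendability condition of Friedman and
  Pippenger for binary forests. Counting the children of \<open>S\<close> on the right, instead of lowering the
  demand of each vertex, makes it inherited by arbitrary subsets of \<open>F\<close>
  (\<open>extendable_subset\<close>), so that unused branches can be given back.\<close>

definition extendable :: "nat set \<Rightarrow> (nat \<Rightarrow> nat) \<Rightarrow> (nat \<Rightarrow> bool) \<Rightarrow> bool" where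
  "extendable F par ent \<longleftrightarrow> F \<subseteq> {..<l} \<and> (\<forall>i\<in>F. E (par i) (pv i (ent i))) \<and>
     (\<forall>S\<subseteq>X. card S \<le> 2 * m \<longrightarrow> 2 * card S \<le> card (nbrs S - F) + card {i\<in>F. par i \<in> S})"

text \<open>For an extendable forest these are the sets of fewer than \<open>m\<close> vertices with
  equality in the extendability condition. The size bound keeps the union of two of them, or one
  with a vertex added, within the range \<open>2 * m\<close> of that condition.\<close>

definition tight :: "nat set \<Rightarrow> (nat \<Rightarrow> nat) \<Rightarrow> nat set \<Rightarrow> bool" where
  "tight F par S \<longleftrightarrow> S \<subseteq> X \<and> card S < m \<and> card (nbrs S - F) + card {i\<in>F. par i \<in> S} \<le> 2 * card S"

lemma finite_nbrs [simp]: "finite (nbrs S)"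
  by (simp add: nbrs_def)

lemma nbrs_Un: "nbrs (S \<union> T) = nbrs S \<union> nbrs T"
  by (auto simp: nbrs_def)

lemma finite_subset_X: "S \<subseteq> X \<Longrightarrow> finite S"
  using fin_X finite_subset by blast

lemma extendable_finite: "extendable F par ent \<Longrightarrow> finite F"
  unfolding extendable_def using finite_subset by blast

lemma extendableD:
  "extendable F par ent \<Longrightarrow> S \<subseteq> X \<Longrightarrow> card S \<le> 2 * m \<Longrightarrow>
    2 * card S \<le> card (nbrs S - F) + card {i\<in>F. par i \<in> S}"
  by (simp add: extendable_def)

lemma extendable_empty: "extendable {} par ent"
  using small_expand by (auto simp: extendable_def nbrs_def)

text \<open>An index that is given back and had its parent in \<open>S\<close> is lost as a child of
  \<open>S\<close>, but it is adjacent to \<open>S\<close> and reappears as a free neighbour. The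
  right-hand side therefore cannot decrease.\<close>

lemma extendable_subset:
  assumes inv: "extendable F par ent" and sub: "F' \<subseteq> F"
  shows "extendable F' par ent"
  unfolding extendable_def
proof (intro conjI allI impI)
  have finF: "finite F" using extendable_finite[OF inv] .
  fix S assume S: "S \<subseteq> X" "card S \<le> 2 * m"
  have ch: "{i\<in>F - F'. par i \<in> S} \<subseteq> nbrs S"
    using inv by (auto simp: extendable_def nbrs_def)
  have "card {i\<in>F. par i \<in> S} = card {i\<in>F - F'. par i \<in> S} + card {i\<in>F'. par i \<in> S}"
    using sub finF finite_subset[OF sub finF] by (subst card_Un_disjoint[symmetric]) (auto intro!: arg_cong[of _ _ card])
  moreover have "card (nbrs S - F) + card {i\<in>F - F'. par i \<in> S} \<le> card (nbrs S - F')"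
    using ch sub finF by (subst card_Un_disjoint[symmetric]) (auto intro!: card_mono)
  moreover have "2 * card S \<le> card (nbrs S - F) + card {i\<in>F. par i \<in> S}"
    by (rule extendableD[OF inv S])
  ultimately show "2 * card S \<le> card (nbrs S - F') + card {i\<in>F'. par i \<in> S}" by linarith
qed (use inv sub in \<open>auto simp: extendable_def\<close>)

text \<open>A gap in sizes: a set of between \<open>m\<close> and \<open>2 * m\<close> vertices
  keeps more than \<open>4 * m\<close> free neighbours, which is too many for the last
  assumption.\<close>

lemma card_lt_m_if_not_expanding:
  assumes "card F \<le> c" "finite F" "S \<subseteq> X" "card S \<le> 2 * m" "card (nbrs S - F) \<le> 2 * card S"
  shows "card S < m"
proof (rule ccontr)
  assume "\<not> card S < m"
  hence "4 * m + c < card (nbrs S)" using large_expand assms(3) by (simp add: nbrs_def)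
  moreover have "card (nbrs S) - card F \<le> card (nbrs S - F)" by (rule diff_card_le_card_Diff[OF assms(2)])
  ultimately show False using assms by linarith
qed

text \<open>The number of free neighbours is submodular, while the child count and the cardinality
  are modular. Extendability at the intersection thus forces equality at the union, and the gap in
  sizes brings the union back below \<open>m\<close>.\<close>

lemma tight_Un:
  assumes inv: "extendable F par ent" and cF: "card F \<le> c"
    and A: "tight F par A" and B: "tight F par B"
  shows "tight F par (A \<union> B)"
proof -
  have finF: "finite F" using extendable_finite[OF inv] .
  have AB: "A \<subseteq> X" "B \<subseteq> X" "card A < m" "card B < m" using A B by (auto simp: tight_def)
  note fAB = finite_subset_X[OF AB(1)] finite_subset_X[OF AB(2)]
  have c1: "card (A \<union> B) + card (A \<inter> B) = card A + card B"
    using card_Un_Int[OF fAB] by linarith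
  have "nbrs (A \<inter> B) - F \<subseteq> (nbrs A - F) \<inter> (nbrs B - F)" by (auto simp: nbrs_def)
  hence "card (nbrs (A \<inter> B) - F) \<le> card ((nbrs A - F) \<inter> (nbrs B - F))" by (intro card_mono) auto
  moreover have "card (nbrs A - F) + card (nbrs B - F) =
      card (nbrs (A \<union> B) - F) + card ((nbrs A - F) \<inter> (nbrs B - F))"
    using card_Un_Int[of "nbrs A - F" "nbrs B - F"] by (simp add: nbrs_Un Un_Diff)
  moreover have "card {i\<in>F. par i \<in> A} + card {i\<in>F. par i \<in> B} =
      card {i\<in>F. par i \<in> A \<union> B} + card {i\<in>F. par i \<in> A \<inter> B}"
  proof -
    have "{i\<in>F. par i \<in> A \<union> B} = {i\<in>F. par i \<in> A} \<union> {i\<in>F. par i \<in> B}"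
      "{i\<in>F. par i \<in> A \<inter> B} = {i\<in>F. par i \<in> A} \<inter> {i\<in>F. par i \<in> B}" by auto
    thus ?thesis using card_Un_Int[of "{i\<in>F. par i \<in> A}" "{i\<in>F. par i \<in> B}"] finF by simp
  qed
  moreover have "card (A \<inter> B) \<le> card A" using fAB by (intro card_mono) auto
  hence "2 * card (A \<inter> B) \<le> card (nbrs (A \<inter> B) - F) + card {i\<in>F. par i \<in> A \<inter> B}"
    using AB by (intro extendableD[OF inv]) auto
  ultimately have t: "card (nbrs (A \<union> B) - F) + card {i\<in>F. par i \<in> A \<union> B} \<le> 2 * card (A \<union> B)"
    using A B c1 unfolding tight_def by linarith
  moreover have "card (A \<union> B) < m"
    using t AB c1 by (intro card_lt_m_if_not_expanding[OF cF finF]) auto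
  ultimately show ?thesis using AB by (simp add: tight_def)
qed

text \<open>If \<open>s \<in> S\<close>, the loss of the free neighbour \<open>i\<close> is offset
  by the new child. Otherwise the condition can fail only for a set that sees \<open>i\<close> and
  had no slack, that is, a tight one.\<close>

lemma extend_or_tight:
  assumes inv: "extendable F par ent" and cF: "card F \<le> c" and s: "s \<in> X"
    and i: "i < l" "i \<notin> F" and e: "E s (pv i b)"
  shows "extendable (insert i F) (par(i := s)) (ent(i := b)) \<or>
    (\<exists>S. tight F par S \<and> s \<notin> S \<and> i \<in> nbrs S)"
proof (rule disjCI)
  have finF: "finite F" using extendable_finite[OF inv] .
  assume no: "\<not> (\<exists>S. tight F par S \<and> s \<notin> S \<and> i \<in> nbrs S)"
  show "extendable (insert i F) (par(i := s)) (ent(i := b))"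
    unfolding extendable_def
  proof (intro conjI allI impI)
    fix S assume S: "S \<subseteq> X" "card S \<le> 2 * m"
    have old: "2 * card S \<le> card (nbrs S - F) + card {j\<in>F. par j \<in> S}"
      by (rule extendableD[OF inv S])
    show "2 * card S \<le> card (nbrs S - insert i F) + card {j \<in> insert i F. (par(i := s)) j \<in> S}"
    proof (cases "s \<in> S")
      case True
      hence "{j \<in> insert i F. (par(i := s)) j \<in> S} = insert i {j\<in>F. par j \<in> S}" using i by auto
      hence "card {j \<in> insert i F. (par(i := s)) j \<in> S} = Suc (card {j\<in>F. par j \<in> S})" using i finF by simp
      moreover have "card (nbrs S - F) \<le> Suc (card (nbrs S - insert i F))"
      proof -
        have "card (nbrs S - F) \<le> card (insert i (nbrs S - insert i F))" by (intro card_mono) auto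
        also have "\<dots> = Suc (card (nbrs S - insert i F))" by (simp add: card_insert_if)
        finally show ?thesis .
      qed
      ultimately show ?thesis using old by linarith
    next
      case False
      hence ch: "{j \<in> insert i F. (par(i := s)) j \<in> S} = {j\<in>F. par j \<in> S}" using i by auto
      show ?thesis
      proof (cases "i \<in> nbrs S")
        case True
        have ins: "nbrs S - F = insert i (nbrs S - insert i F)" using True i by auto
        have cd: "card (nbrs S - F) = Suc (card (nbrs S - insert i F))"
          by (subst ins) (simp add: card_insert_if)
        show ?thesis
        proof (rule ccontr)
          assume "\<not> ?thesis"
          hence t: "card (nbrs S - F) + card {j\<in>F. par j \<in> S} \<le> 2 * card S" using ch cd by simp
          moreover have "card S < m"
            using t by (intro card_lt_m_if_not_expanding[OF cF finF S]) auto
          ultimately have "tight F par S" using S by (simp add: tight_def)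
          thus False using no False True by blast
        qed
      next
        case False
        hence "nbrs S - insert i F = nbrs S - F" by auto
        thus ?thesis using old ch by simp
      qed
    qed
  qed (use inv i e in \<open>auto simp: extendable_def\<close>)
qed

text \<open>If every free neighbour of \<open>s\<close> were blocked by a tight set, the union
  \<open>S\<close> of these sets would be tight and see all of them. Adding \<open>s\<close> to
  \<open>S\<close> then brings no free neighbour and at most one child, while the demand rises by
  two.\<close>

lemma extend:
  assumes inv: "extendable F par ent" and cF: "card F \<le> c" and s: "s \<in> X"
    and deg: "card {i\<in>F. par i = s} < 2"
  obtains i b where "i < l" "i \<notin> F" "E s (pv i b)" "extendable (insert i F) (par(i := s)) (ent(i := b))"
proof (rule ccontr)
  note found = that
  assume neg: "\<not> thesis"
  have finF: "finite F" using extendable_finite[OF inv] .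
  have bad: "\<exists>S. tight F par S \<and> s \<notin> S \<and> i \<in> nbrs S" if i: "i \<in> nbrs {s} - F" for i
  proof -
    from i obtain b where "E s (pv i b)" "i < l" "i \<notin> F" by (auto simp: nbrs_def)
    thus ?thesis using extend_or_tight[OF inv cF s, of i b] found[of i b] neg by blast
  qed
  have "\<exists>S. tight F par S \<and> s \<notin> S \<and> C \<subseteq> nbrs S" if "finite C" "C \<subseteq> nbrs {s} - F" for C
    using that
  proof (induction C)
    case empty
    have "tight F par {}" using m_pos by (simp add: tight_def nbrs_def)
    thus ?case by blast
  next
    case (insert i C)
    then obtain A where "tight F par A" "s \<notin> A" "C \<subseteq> nbrs A" by auto
    moreover from bad insert.prems obtain B where "tight F par B" "s \<notin> B" "i \<in> nbrs B" by blast
    ultimately show ?case using tight_Un[OF inv cF] by (intro exI[of _ "A \<union> B"]) (auto simp: nbrs_Un)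
  qed
  from this[of "nbrs {s} - F"] obtain S where S: "tight F par S" "s \<notin> S" "nbrs {s} - F \<subseteq> nbrs S" by auto
  let ?S = "insert s S"
  have fS: "finite S" using S(1) finite_subset_X by (simp add: tight_def)
  have cS: "card ?S = Suc (card S)" using S(2) fS by simp
  have "?S \<subseteq> X" "card ?S \<le> 2 * m" using S s cS by (auto simp: tight_def)
  from extendableD[OF inv this]
  have "2 * card ?S \<le> card (nbrs ?S - F) + card {i\<in>F. par i \<in> ?S}" .
  moreover have "nbrs ?S - F = nbrs S - F" using S(3) nbrs_Un[of "{s}" S] by auto
  moreover have "card {i\<in>F. par i \<in> ?S} \<le> card {i\<in>F. par i \<in> S} + card {i\<in>F. par i = s}"
    using finF by (intro order_trans[OF card_mono card_Un_le]) auto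
  ultimately show False using S(1) deg cS by (simp add: tight_def)
qed

section \<open>Growing binary trees of traversals\<close>

text \<open>This adds one level of a tree. The vertices of \<open>W\<close> start childless, so
  \<open>extend\<close> can be applied exactly twice at each of them.\<close>

lemma add_two_children:
  assumes "finite W" "W \<subseteq> X" "extendable F par ent" "\<And>j. j \<in> F \<Longrightarrow> par j \<notin> W" "card F + 2 * card W \<le> c"
  shows "\<exists>F' par' ent'. extendable F' par' ent' \<and> F \<subseteq> F' \<and> card F' = card F + 2 * card W \<and>
    (\<forall>j\<in>F. par' j = par j \<and> ent' j = ent j) \<and> (\<forall>j\<in>F' - F. par' j \<in> W)"
  using assms
proof (induction W)
  case empty
  thus ?case by (intro exI[of _ F] exI[of _ par] exI[of _ ent]) auto
next
  case (insert w W)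
  then obtain F1 p1 e1 where 1: "extendable F1 p1 e1" "F \<subseteq> F1" "card F1 = card F + 2 * card W"
    "\<forall>j\<in>F. p1 j = par j \<and> e1 j = ent j" "\<forall>j\<in>F1 - F. p1 j \<in> W" by auto
  have w: "w \<in> X" using insert.prems by simp
  have cW: "card F + 2 * card W + 2 \<le> c" using insert by simp
  have f1: "finite F1" using extendable_finite[OF 1(1)] .
  have no: "p1 j \<noteq> w" if "j \<in> F1" for j
    using that 1 insert.hyps(2) insert.prems(3) by (cases "j \<in> F") auto
  have ch1: "{j\<in>F1. p1 j = w} = {}" using no by auto
  have c1: "card {j\<in>F1. p1 j = w} < 2" unfolding ch1 by simp
  have "card F1 \<le> c" using 1(3) cW by simp
  from extend[OF 1(1) this w c1] obtain i b where
    i: "i < l" "i \<notin> F1" and 2: "extendable (insert i F1) (p1(i := w)) (e1(i := b))" by blast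
  let ?F2 = "insert i F1" and ?p2 = "p1(i := w)" and ?e2 = "e1(i := b)"
  have ch2: "{j\<in>?F2. ?p2 j = w} = {i}" using no i by auto
  have c2: "card {j\<in>?F2. ?p2 j = w} < 2" unfolding ch2 by simp
  have "card ?F2 \<le> c" using 1(3) cW i f1 by simp
  from extend[OF 2 this w c2] obtain i' b' where
    i': "i' < l" "i' \<notin> ?F2" and 3: "extendable (insert i' ?F2) (?p2(i' := w)) (?e2(i' := b'))" by blast
  show ?case
  proof (intro exI conjI)
    show "extendable (insert i' ?F2) (?p2(i' := w)) (?e2(i' := b'))" by (rule 3)
    show "card (insert i' ?F2) = card F + 2 * card (insert w W)"
      using i i' f1 1(3) insert.hyps by simp
  qed (use 1 i i' in auto)
qed

text \<open>Its use is the contrapositive: an index outside \<open>F\<close> has no children at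
  either port, so every newly added index is a leaf.\<close>

definition parent_closed :: "nat set \<Rightarrow> (nat \<Rightarrow> nat) \<Rightarrow> bool" where
  "parent_closed F par \<longleftrightarrow> (\<forall>j\<in>F. \<forall>i<l. \<forall>b. par j = pv i b \<longrightarrow> i \<in> F)"

definition chain :: "(nat \<Rightarrow> nat) \<Rightarrow> (nat \<Rightarrow> bool) \<Rightarrow> nat list \<Rightarrow> bool" where
  "chain par ent = successively (\<lambda>i j. par j = pv i (\<not> ent i))"

lemma chain_cong:
  assumes "\<And>i. i \<in> set cs \<Longrightarrow> par i = par' i \<and> ent i = ent' i"
  shows "chain par ent cs = chain par' ent' cs"
  unfolding chain_def by (rule successively_cong) (use assms in auto)

text \<open>The tree grows level by level from the root \<open>i0\<close>, with \<open>L\<close> as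
  its last level. A tree of depth \<open>k\<close> has \<open>2 * 2 ^ k - 2\<close> indices besides
  the root; the \<open>+ 2\<close> on the other side avoids truncated subtraction. The index lists
  \<open>cs\<close> are the branches from the root to the leaves.\<close>

lemma grow_binary_tree:
  assumes inv: "extendable F par ent" and cl: "parent_closed F par"
    and i0: "i0 \<in> F" "\<And>j. j \<in> F \<Longrightarrow> par j \<noteq> pv i0 (\<not> ent i0)"
    and c: "card F + 2 * 2 ^ k \<le> c + 2"
  shows "\<exists>F' par' ent' L. extendable F' par' ent' \<and> parent_closed F' par' \<and> F \<subseteq> F' \<and>
    card F' + 2 = card F + 2 * 2 ^ k \<and>
    (\<forall>j\<in>F. par' j = par j \<and> ent' j = ent j) \<and>
    (\<forall>j\<in>F' - F. \<exists>i\<in>insert i0 (F' - F). par' j = pv i (\<not> ent' i)) \<and>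
    L \<subseteq> insert i0 (F' - F) \<and> card L = 2 ^ k \<and>
    (\<forall>i\<in>L. \<forall>j\<in>F'. par' j \<noteq> pv i (\<not> ent' i)) \<and>
    (\<forall>i\<in>L. \<exists>cs. cs \<noteq> [] \<and> hd cs = i0 \<and> last cs = i \<and> length cs = Suc k \<and> distinct cs \<and>
       set cs \<subseteq> insert i0 (F' - F) \<and> chain par' ent' cs)"
  using c
proof (induction k)
  case 0
  show ?case
    by (intro exI[of _ F] exI[of _ par] exI[of _ ent] exI[of _ "{i0}"])
      (use inv cl i0 in \<open>auto intro!: exI[of _ "[i0]"] simp: chain_def\<close>)
next
  case (Suc k)
  then obtain F1 p1 e1 L where
    inv1: "extendable F1 p1 e1" and cl1: "parent_closed F1 p1" and FF1: "F \<subseteq> F1"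
    and c1: "card F1 + 2 = card F + 2 * 2 ^ k"
    and ag1: "\<forall>j\<in>F. p1 j = par j \<and> e1 j = ent j"
    and new1: "\<forall>j\<in>F1 - F. \<exists>i\<in>insert i0 (F1 - F). p1 j = pv i (\<not> e1 i)"
    and L: "L \<subseteq> insert i0 (F1 - F)" "card L = 2 ^ k" "\<forall>i\<in>L. \<forall>j\<in>F1. p1 j \<noteq> pv i (\<not> e1 i)"
    and ch1: "\<forall>i\<in>L. \<exists>cs. cs \<noteq> [] \<and> hd cs = i0 \<and> last cs = i \<and> length cs = Suc k \<and> distinct cs \<and>
       set cs \<subseteq> insert i0 (F1 - F) \<and> chain p1 e1 cs"
    by auto
  have F1l: "F1 \<subseteq> {..<l}" using inv1 by (simp add: extendable_def)
  have LF1: "L \<subseteq> F1" using L(1) i0(1) FF1 by auto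
  have finL: "finite L" using LF1 extendable_finite[OF inv1] finite_subset by blast
  let ?W = "(\<lambda>i. pv i (\<not> e1 i)) ` L"
  have inj: "inj_on (\<lambda>i. pv i (\<not> e1 i)) L"
    using LF1 F1l pv_eqD by (intro inj_onI) blast
  have cW: "card ?W = 2 ^ k" using card_image[OF inj] L(2) by simp
  have "\<exists>F' par' ent'. extendable F' par' ent' \<and> F1 \<subseteq> F' \<and> card F' = card F1 + 2 * card ?W \<and>
    (\<forall>j\<in>F1. par' j = p1 j \<and> ent' j = e1 j) \<and> (\<forall>j\<in>F' - F1. par' j \<in> ?W)"
  proof (rule add_two_children[OF _ _ inv1])
    show "?W \<subseteq> X" using LF1 F1l pv_in_X by blast
    show "\<And>j. j \<in> F1 \<Longrightarrow> p1 j \<notin> ?W" using L(3) by blast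
    show "card F1 + 2 * card ?W \<le> c" using Suc.prems c1 cW by simp
  qed (use finL in simp)
  then obtain F2 p2 e2 where inv2: "extendable F2 p2 e2" and F12: "F1 \<subseteq> F2"
    and c2: "card F2 = card F1 + 2 * 2 ^ k"
    and ag2: "\<forall>j\<in>F1. p2 j = p1 j \<and> e2 j = e1 j" and new2: "\<forall>j\<in>F2 - F1. p2 j \<in> ?W"
    unfolding cW by blast
  have fin2: "finite F2" using extendable_finite[OF inv2] .
  have F2l: "F2 \<subseteq> {..<l}" using inv2 by (simp add: extendable_def)
  have par_new: "\<exists>i\<in>L. p2 j = pv i (\<not> e2 i)" if "j \<in> F2 - F1" for j
  proof -
    from new2 that obtain i where "i \<in> L" "p2 j = pv i (\<not> e1 i)" by blast
    thus ?thesis using ag2 LF1 by (intro bexI[of _ i]) auto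
  qed
  have cl2: "parent_closed F2 p2"
    unfolding parent_closed_def
  proof (intro ballI allI impI)
    fix j i b assume j: "j \<in> F2" and i: "i < l" and e: "p2 j = pv i b"
    show "i \<in> F2"
    proof (cases "j \<in> F1")
      case True
      hence "p1 j = pv i b" using ag2 e by simp
      hence "i \<in> F1" using cl1 True i unfolding parent_closed_def by blast
      thus ?thesis using F12 by blast
    next
      case False
      then obtain i' where "i' \<in> L" "p2 j = pv i' (\<not> e2 i')" using par_new j by blast
      hence "i = i'" using e pv_eqD[OF i, of i'] LF1 F1l by (metis lessThan_iff subsetD)
      thus ?thesis using \<open>i' \<in> L\<close> LF1 F12 by blast
    qed
  qed
  show ?case
  proof (intro exI conjI)
    show "extendable F2 p2 e2" "parent_closed F2 p2" by fact+
    show "F \<subseteq> F2" using FF1 F12 by blast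
    show "card F2 + 2 = card F + 2 * 2 ^ Suc k" using c1 c2 by simp
    show "\<forall>j\<in>F. p2 j = par j \<and> e2 j = ent j" using ag1 ag2 FF1 by auto
    show "\<forall>j\<in>F2 - F. \<exists>i\<in>insert i0 (F2 - F). p2 j = pv i (\<not> e2 i)"
    proof
      fix j assume j: "j \<in> F2 - F"
      show "\<exists>i\<in>insert i0 (F2 - F). p2 j = pv i (\<not> e2 i)"
      proof (cases "j \<in> F1")
        case True
        then obtain i where i: "i \<in> insert i0 (F1 - F)" "p1 j = pv i (\<not> e1 i)" using new1 j by blast
        hence "i \<in> F1" using i0 FF1 by auto
        thus ?thesis using i True ag2 F12 by (intro bexI[of _ i]) auto
      next
        case False
        then obtain i where "i \<in> L" "p2 j = pv i (\<not> e2 i)" using par_new j by blast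
        thus ?thesis using L(1) F12 by (intro bexI[of _ i]) auto
      qed
    qed
    \<comment> \<open>The witness for the new leaf set is the level just added.\<close>
    show "F2 - F1 \<subseteq> insert i0 (F2 - F)" using FF1 by auto
    show "card (F2 - F1) = 2 ^ Suc k"
      using c2 F12 fin2 by (simp add: card_Diff_subset finite_subset)
    show "\<forall>i\<in>F2 - F1. \<forall>j\<in>F2. p2 j \<noteq> pv i (\<not> e2 i)"
    proof (intro ballI notI)
      fix i j assume i: "i \<in> F2 - F1" and j: "j \<in> F2" and e: "p2 j = pv i (\<not> e2 i)"
      have il: "i < l" using i F2l by auto
      show False
      proof (cases "j \<in> F1")
        case True
        hence "p1 j = pv i (\<not> e2 i)" using ag2 e by simp
        hence "i \<in> F1" using cl1 True il unfolding parent_closed_def by blast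
        thus False using i by blast
      next
        case False
        then obtain i' where "i' \<in> L" "p2 j = pv i' (\<not> e2 i')" using par_new j by blast
        hence "i = i'" using e pv_eqD[OF il, of i'] LF1 F1l by (metis lessThan_iff subsetD)
        thus False using \<open>i' \<in> L\<close> LF1 i by blast
      qed
    qed
    show "\<forall>i\<in>F2 - F1. \<exists>cs. cs \<noteq> [] \<and> hd cs = i0 \<and> last cs = i \<and> length cs = Suc (Suc k) \<and> distinct cs \<and>
       set cs \<subseteq> insert i0 (F2 - F) \<and> chain p2 e2 cs"
    proof
      fix j assume j: "j \<in> F2 - F1"
      obtain i where i: "i \<in> L" "p2 j = pv i (\<not> e2 i)" using par_new j by blast
      then obtain cs where cs: "cs \<noteq> []" "hd cs = i0" "last cs = i" "length cs = Suc k" "distinct cs"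
        "set cs \<subseteq> insert i0 (F1 - F)" "chain p1 e1 cs" using ch1 by blast
      have csF: "set cs \<subseteq> F1" using cs(6) i0 FF1 by auto
      have "chain p2 e2 cs" using cs(7) ag2 csF by (subst chain_cong[of _ _ p1 _ e1]) auto
      hence "chain p2 e2 (cs @ [j])" using i cs by (simp add: chain_def successively_append_iff)
      moreover have "distinct (cs @ [j])" using cs(5) csF j by auto
      moreover have "set (cs @ [j]) \<subseteq> insert i0 (F2 - F)" using cs(6) j F12 FF1 by auto
      ultimately show "\<exists>cs. cs \<noteq> [] \<and> hd cs = i0 \<and> last cs = j \<and> length cs = Suc (Suc k) \<and> distinct cs \<and>
       set cs \<subseteq> insert i0 (F2 - F) \<and> chain p2 e2 cs"
        using cs by (intro exI[of _ "cs @ [j]"]) auto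
    qed
  qed
qed

section \<open>Linking terminals by two joined trees\<close>

text \<open>The branch at \<open>s\<close> is walked down, the edge between the leaves is crossed,
  and the branch at \<open>t\<close> is walked up. Walking up reverses each crossing, hence the
  entries \<open>\<not> ent i\<close> in the second half.\<close>

lemma linked_chains:
  assumes "cs \<noteq> []" "cs' \<noteq> []" "chain par ent cs" "chain par ent cs'"
    and ent: "\<And>i. i \<in> set cs \<union> set cs' \<Longrightarrow> E (par i) (pv i (ent i))"
    and s: "par (hd cs) = s" and t: "par (hd cs') = t"
    and mid: "E (pv (last cs) (\<not> ent (last cs))) (pv (last cs') (\<not> ent (last cs')))"
  shows "linked E pv s (map (\<lambda>i. (i, ent i)) cs @ rev (map (\<lambda>i. (i, \<not> ent i)) cs')) t"
proof -
  let ?R = "\<lambda>p q. E (pv (fst p) (\<not> snd p)) (pv (fst q) (snd q))"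
  have "successively (\<lambda>i j. E (pv i (\<not> ent i)) (pv j (ent j))) cs"
    using assms(3) ent unfolding chain_def by (elim successively_mono) (metis UnI1)
  moreover have "successively (\<lambda>i j. E (pv j (ent j)) (pv i (\<not> ent i))) cs'"
    using assms(4) ent unfolding chain_def by (elim successively_mono) (metis E_sym UnI2)
  ultimately have "successively ?R (map (\<lambda>i. (i, ent i)) cs @ rev (map (\<lambda>i. (i, \<not> ent i)) cs'))"
    using mid assms(1,2) by (auto simp: successively_append_iff successively_map hd_rev last_map)
  moreover have "E s (pv (hd cs) (ent (hd cs)))" "E (pv (hd cs') (ent (hd cs'))) t"
    using s t ent[of "hd cs"] ent[of "hd cs'"] assms(1,2) E_sym by auto
  ultimately show ?thesis
    using assms(1,2) by (auto simp: linked_def hd_append last_rev hd_map)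
qed

text \<open>Both roots are placed first; then a tree is grown from each, two leaves are joined, and
  all but the two branches is given back. The trees need fewer than \<open>4 * 2 ^ k\<close> indices
  for the moment, but only \<open>2 * (k + 1)\<close> remain in use. The degree assumption counts
  children together with pending uses as a terminal, so each terminal keeps a free slot for every
  use.\<close>

lemma link_pair:
  assumes inv: "extendable F par ent" and cl: "parent_closed F par"
    and s: "s \<in> X" "\<And>i b. i < l \<Longrightarrow> s \<noteq> pv i b" and t: "t \<in> X" "\<And>i b. i < l \<Longrightarrow> t \<noteq> pv i b"
    and deg: "\<And>v. (\<And>i b. i < l \<Longrightarrow> v \<noteq> pv i b) \<Longrightarrow>
      card {i\<in>F. par i = v} + (if v = s then 1 else 0) + (if v = t then 1 else 0) \<le> 2"
    and k: "m \<le> 2 ^ k" and c: "card F + 4 * 2 ^ k \<le> c"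
  obtains F' par' ent' qs where "extendable F' par' ent'" "parent_closed F' par'" "F \<subseteq> F'"
    "card F' \<le> card F + 2 * (k + 1)"
    "\<And>v. (\<And>i b. i < l \<Longrightarrow> v \<noteq> pv i b) \<Longrightarrow>
       card {i\<in>F'. par' i = v} \<le> card {i\<in>F. par i = v} + (if v = s then 1 else 0) + (if v = t then 1 else 0)"
    "linked E pv s qs t" "distinct (map fst qs)" "fst ` set qs \<subseteq> F' - F"
proof -
  have finF: "finite F" using extendable_finite[OF inv] .
  have Fl: "F \<subseteq> {..<l}" using inv by (simp add: extendable_def)
  have k1: "1 \<le> (2::nat) ^ k" by simp
  have "card {i\<in>F. par i = s} < 2" using deg[OF s(2)] by simp
  moreover have "card F \<le> c" using c by linarith
  ultimately obtain i0 b0 where i0: "i0 < l" "i0 \<notin> F"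
    and inv1: "extendable (insert i0 F) (par(i0 := s)) (ent(i0 := b0))"
    using extend[OF inv _ s(1)] by blast
  let ?F1 = "insert i0 F" and ?p1 = "par(i0 := s)" and ?e1 = "ent(i0 := b0)"
  have cF1: "card ?F1 = Suc (card F)" using i0 finF by simp
  \<comment> \<open>In the case \<open>t = s\<close> the root \<open>i0\<close> already takes one of
    the two slots at \<open>t\<close>; the degree assumption then says that both were empty
    before.\<close>
  have "{i\<in>?F1. ?p1 i = t} \<subseteq> {i\<in>F. par i = t} \<union> (if t = s then {i0} else {})" by auto
  hence "card {i\<in>?F1. ?p1 i = t} \<le> card ({i\<in>F. par i = t} \<union> (if t = s then {i0} else {}))"
    using finF by (intro card_mono) auto
  also have "\<dots> \<le> card {i\<in>F. par i = t} + card (if t = s then {i0} else {})" by (rule card_Un_le)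
  also have "\<dots> < 2" using deg[OF t(2)] by (auto split: if_splits)
  finally have "card {i\<in>?F1. ?p1 i = t} < 2" .
  moreover have "card ?F1 \<le> c" using c cF1 k1 by linarith
  ultimately obtain j0 b1 where j0: "j0 < l" "j0 \<notin> ?F1"
    and inv2: "extendable (insert j0 ?F1) (?p1(j0 := t)) (?e1(j0 := b1))"
    using extend[OF inv1 _ t(1)] by blast
  define F2 where "F2 = insert j0 ?F1"
  define p2 where "p2 = ?p1(j0 := t)"
  define e2 where "e2 = ?e1(j0 := b1)"
  note inv2 = inv2[folded F2_def p2_def e2_def]
  have cF2: "card F2 = Suc (Suc (card F))" using j0 finF cF1 by (simp add: F2_def)
  have p2: "p2 i0 = s" "p2 j0 = t" "\<And>j. j \<in> F \<Longrightarrow> p2 j = par j" using i0 j0 by (auto simp: p2_def)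
  have cl2: "parent_closed F2 p2"
    unfolding parent_closed_def
  proof (intro ballI allI impI)
    fix j i b assume j: "j \<in> F2" and i: "i < l" "p2 j = pv i b"
    hence "j \<in> F" using p2 s(2) t(2) by (auto simp: F2_def)
    thus "i \<in> F2" using i p2(3) cl unfolding parent_closed_def by (auto simp: F2_def)
  qed
  have leaf: "p2 j \<noteq> pv i b" if i: "i < l" "i \<notin> F" and j: "j \<in> F2" for i j b
  proof
    assume e: "p2 j = pv i b"
    hence "j \<in> F" using j i p2 s(2) t(2) by (auto simp: F2_def)
    hence "i \<in> F" using i e p2(3) cl unfolding parent_closed_def by auto
    thus False using i by simp
  qed
  have "i0 \<in> F2" "j0 \<in> F2" by (auto simp: F2_def)
  have "card F2 + 2 * 2 ^ k \<le> c + 2" using cF2 c k1 by linarith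
  from grow_binary_tree[OF inv2 cl2 \<open>i0 \<in> F2\<close> leaf[OF i0] this]
  obtain F3 p3 e3 L where inv3: "extendable F3 p3 e3" and cl3: "parent_closed F3 p3" and F23: "F2 \<subseteq> F3"
    and cF3: "card F3 + 2 = card F2 + 2 * 2 ^ k"
    and ag3: "\<forall>j\<in>F2. p3 j = p2 j \<and> e3 j = e2 j"
    and new3: "\<forall>j\<in>F3 - F2. \<exists>i\<in>insert i0 (F3 - F2). p3 j = pv i (\<not> e3 i)"
    and L: "L \<subseteq> insert i0 (F3 - F2)" "card L = 2 ^ k"
    and ch3: "\<forall>i\<in>L. \<exists>cs. cs \<noteq> [] \<and> hd cs = i0 \<and> last cs = i \<and> length cs = Suc k \<and> distinct cs \<and>
       set cs \<subseteq> insert i0 (F3 - F2) \<and> chain p3 e3 cs" by blast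
  have F3l: "F3 \<subseteq> {..<l}" using inv3 by (simp add: extendable_def)
  \<comment> \<open>The second root has stayed childless while the first tree grew, since all new
    indices hang from \<open>i0\<close> or from each other.\<close>
  have leaf3: "p3 j \<noteq> pv j0 (\<not> e3 j0)" if j: "j \<in> F3" for j
  proof (cases "j \<in> F2")
    case True
    thus ?thesis using leaf[OF j0(1), of j] j0(2) ag3 by auto
  next
    case False
    then obtain i where i: "i \<in> insert i0 (F3 - F2)" "p3 j = pv i (\<not> e3 i)" using new3 j by blast
    moreover have "i \<noteq> j0" using i(1) j0 by (auto simp: F2_def)
    ultimately show ?thesis using pv_eqD[of i j0] i0(1) j0(1) F3l by auto
  qed
  have "j0 \<in> F3" using F23 by (auto simp: F2_def)
  have "card F3 + 2 * 2 ^ k \<le> c + 2" using cF3 cF2 c by linarith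
  from grow_binary_tree[OF inv3 cl3 \<open>j0 \<in> F3\<close> leaf3 this]
  obtain F4 p4 e4 L' where inv4: "extendable F4 p4 e4" and cl4: "parent_closed F4 p4" and F34: "F3 \<subseteq> F4"
    and ag4: "\<forall>j\<in>F3. p4 j = p3 j \<and> e4 j = e3 j"
    and new4: "\<forall>j\<in>F4 - F3. \<exists>i\<in>insert j0 (F4 - F3). p4 j = pv i (\<not> e4 i)"
    and L': "L' \<subseteq> insert j0 (F4 - F3)" "card L' = 2 ^ k"
    and ch4: "\<forall>i\<in>L'. \<exists>cs. cs \<noteq> [] \<and> hd cs = j0 \<and> last cs = i \<and> length cs = Suc k \<and> distinct cs \<and>
       set cs \<subseteq> insert j0 (F4 - F3) \<and> chain p4 e4 cs" by blast
  have F4l: "F4 \<subseteq> {..<l}" using inv4 by (simp add: extendable_def)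
  have FF: "F \<subseteq> F2" "F2 \<subseteq> F4" using F23 F34 by (auto simp: F2_def)
  let ?ex = "\<lambda>i. pv i (\<not> e4 i)"
  have LF: "L \<subseteq> F4" "L' \<subseteq> F4" using L(1) L'(1) FF F34 by (auto simp: F2_def)
  have inj: "inj_on ?ex M" if "M \<subseteq> F4" for M using that F4l pv_eqD by (intro inj_onI) blast
  have "m \<le> card (?ex ` L)" "m \<le> card (?ex ` L')"
    using card_image[OF inj[OF LF(1)]] card_image[OF inj[OF LF(2)]] L(2) L'(2) k by auto
  moreover have "?ex ` L \<subseteq> X" "?ex ` L' \<subseteq> X" using LF F4l pv_in_X by blast+
  ultimately obtain i j where ij: "i \<in> L" "j \<in> L'" "E (?ex i) (?ex j)" using joined by blast
  obtain cs where cs: "cs \<noteq> []" "hd cs = i0" "last cs = i" "length cs = Suc k" "distinct cs"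
       "set cs \<subseteq> insert i0 (F3 - F2)" "chain p3 e3 cs" using ch3 ij(1) by blast
  obtain cs' where cs': "cs' \<noteq> []" "hd cs' = j0" "last cs' = j" "length cs' = Suc k" "distinct cs'"
       "set cs' \<subseteq> insert j0 (F4 - F3)" "chain p4 e4 cs'" using ch4 ij(2) by blast
  have cs3: "set cs \<subseteq> F3" using cs(6) F23 by (auto simp: F2_def)
  have ch: "chain p4 e4 cs" using cs(7) ag4 cs3 by (subst chain_cong[of _ _ p3 _ e3]) auto
  have disj: "set cs \<inter> set cs' = {}" "set cs \<inter> F = {}" "set cs' \<inter> F = {}"
    using cs(6) cs'(6) cs3 i0 j0 F23 by (auto simp: F2_def)
  \<comment> \<open>Only the earlier indices and the two branches are kept;
    \<open>extendable_subset\<close> permits dropping the rest.\<close>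
  let ?G = "F \<union> set cs \<union> set cs'"
  have G4: "?G \<subseteq> F4" using FF cs3 F34 cs'(6) by (auto simp: F2_def)
  have p4: "p4 i0 = s" "p4 j0 = t" "\<And>j. j \<in> F \<Longrightarrow> p4 j = par j"
    using p2 ag3 ag4 F23 by (auto simp: F2_def)
  \<comment> \<open>Within a branch only the first index can hang from outside it, so keeping whole
    branches preserves \<open>parent_closed\<close>.\<close>
  have par_chain: "\<exists>i\<in>set ds. p4 j = ?ex i" if "chain p4 e4 ds" "j \<in> set ds" "j \<noteq> hd ds" for ds j
    using that
  proof (induction ds)
    case (Cons a ds)
    show ?case
    proof (cases "ds \<noteq> [] \<and> j = hd ds")
      case True
      thus ?thesis using Cons.prems by (cases ds) (auto simp: chain_def)
    next
      case False
      thus ?thesis using Cons by (cases ds) (auto simp: chain_def)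
    qed
  qed simp
  have par_G: "p4 j \<in> {s, t} \<or> (\<exists>i\<in>set cs \<union> set cs'. p4 j = ?ex i)" if "j \<in> set cs \<union> set cs'" for j
    using par_chain[OF ch, of j] par_chain[OF cs'(7), of j] that cs(2) cs'(2) p4(1,2) by auto
  show thesis
  proof (rule that[of ?G p4 e4 "map (\<lambda>i. (i, e4 i)) cs @ rev (map (\<lambda>i. (i, \<not> e4 i)) cs')"])
    show "extendable ?G p4 e4" by (rule extendable_subset[OF inv4 G4])
    show "parent_closed ?G p4"
      unfolding parent_closed_def
    proof (intro ballI allI impI)
      fix j i b assume j: "j \<in> ?G" and i: "i < l" and e: "p4 j = pv i b"
      show "i \<in> ?G"
      proof (cases "j \<in> F")
        case True
        hence "i \<in> F" using cl i e p4(3) unfolding parent_closed_def by auto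
        thus ?thesis by blast
      next
        case False
        then obtain i' where i': "i' \<in> set cs \<union> set cs'" "p4 j = ?ex i'"
          using par_G[of j] j e s(2)[OF i] t(2)[OF i] by auto
        hence "i = i'" using e pv_eqD[OF i, of i'] G4 F4l by auto
        thus ?thesis using i' by blast
      qed
    qed
    show "card ?G \<le> card F + 2 * (k + 1)"
    proof -
      have "card ?G \<le> card F + card (set cs) + card (set cs')"
        by (intro order_trans[OF card_Un_le] add_right_mono card_Un_le)
      thus ?thesis using cs(4,5) cs'(4,5) by (simp add: distinct_card)
    qed
    show "card {i\<in>?G. p4 i = v} \<le> card {i\<in>F. par i = v} + (if v = s then 1 else 0) + (if v = t then 1 else 0)"
      if v: "\<And>i b. i < l \<Longrightarrow> v \<noteq> pv i b" for v
    proof -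
      have nochain: "j = hd ds" if ds: "chain p4 e4 ds" "set ds \<subseteq> F4" and j: "j \<in> set ds" "p4 j = v" for ds j
      proof (rule ccontr)
        assume "j \<noteq> hd ds"
        from par_chain[OF ds(1) j(1) this] obtain i where i: "i \<in> set ds" "v = ?ex i" using j(2) by auto
        hence "i < l" using ds(2) F4l by auto
        from v[OF this] i(2) show False by blast
      qed
      have hd1: "j = i0" if "j \<in> set cs" "p4 j = v" for j
        using nochain[OF ch _ that] G4 cs(2) by simp
      have hd2: "j = j0" if "j \<in> set cs'" "p4 j = v" for j
        using nochain[OF cs'(7) _ that] G4 cs'(2) by simp
      have "{i\<in>?G. p4 i = v} \<subseteq> {i\<in>F. par i = v} \<union> (if v = s then {i0} else {}) \<union> (if v = t then {j0} else {})"
      proof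
        fix j assume "j \<in> {i\<in>?G. p4 i = v}"
        then consider "j \<in> F" "p4 j = v" | "j \<in> set cs" "p4 j = v" | "j \<in> set cs'" "p4 j = v" by blast
        thus "j \<in> {i\<in>F. par i = v} \<union> (if v = s then {i0} else {}) \<union> (if v = t then {j0} else {})"
        proof cases
          case 1
          thus ?thesis using p4(3)[of j] by simp
        next
          case 2
          hence "j = i0" "v = s" using hd1 p4(1) by blast+
          thus ?thesis by simp
        next
          case 3
          hence "j = j0" "v = t" using hd2 p4(2) by blast+
          thus ?thesis by simp
        qed
      qed
      hence "card {i\<in>?G. p4 i = v} \<le> card ({i\<in>F. par i = v} \<union> (if v = s then {i0} else {}) \<union> (if v = t then {j0} else {}))"
        using finF by (intro card_mono) auto
      also have "\<dots> \<le> card {i\<in>F. par i = v} + card (if v = s then {i0} else {}) + card (if v = t then {j0} else {})"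
        by (intro order_trans[OF card_Un_le] add_right_mono card_Un_le)
      finally show ?thesis by (auto split: if_splits)
    qed
    show "linked E pv s (map (\<lambda>i. (i, e4 i)) cs @ rev (map (\<lambda>i. (i, \<not> e4 i)) cs')) t"
    proof (rule linked_chains[OF cs(1) cs'(1) ch cs'(7)])
      show "E (p4 i) (pv i (e4 i))" if "i \<in> set cs \<union> set cs'" for i
        using that G4 inv4 by (auto simp: extendable_def)
    qed (use cs cs' p4 ij in auto)
    show "distinct (map fst (map (\<lambda>i. (i, e4 i)) cs @ rev (map (\<lambda>i. (i, \<not> e4 i)) cs')))"
      using cs(5) cs'(5) disj by (simp add: rev_map comp_def)
    show "fst ` set (map (\<lambda>i. (i, e4 i)) cs @ rev (map (\<lambda>i. (i, \<not> e4 i)) cs')) \<subseteq> ?G - F"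
      using disj by (auto simp: image_Un image_image)
  qed auto
qed

text \<open>Only the branches accumulate, at \<open>2 * (k + 1)\<close> indices per link. The term
  \<open>4 * 2 ^ k\<close> enters once, for the trees of the link under construction.\<close>

lemma link_pairs:
  assumes "extendable F par ent" "parent_closed F par"
    and "\<And>v. v \<in> set (map fst prs) \<union> set (map snd prs) \<Longrightarrow> v \<in> X \<and> (\<forall>i<l. \<forall>b. v \<noteq> pv i b)"
    and "\<And>v. (\<And>i b. i < l \<Longrightarrow> v \<noteq> pv i b) \<Longrightarrow>
      card {i\<in>F. par i = v} + count_list (map fst prs) v + count_list (map snd prs) v \<le> 2"
    and k: "m \<le> 2 ^ k" and "card F + length prs * (2 * (k + 1)) + 4 * 2 ^ k \<le> c"
  shows "\<exists>qss. length qss = length prs \<and>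
    (\<forall>a<length prs. linked E pv (fst (prs ! a)) (qss ! a) (snd (prs ! a))) \<and>
    distinct (map fst (concat qss)) \<and> fst ` set (concat qss) \<subseteq> {..<l} - F"
  using assms(1-4,6)
proof (induction prs arbitrary: F par ent)
  case Nil
  show ?case by (intro exI[of _ "[]"]) simp
next
  case (Cons pr prs)
  obtain s t where pr: "pr = (s, t)" by force
  have "s \<in> X" "t \<in> X" and np: "\<And>i b. i < l \<Longrightarrow> s \<noteq> pv i b" "\<And>i b. i < l \<Longrightarrow> t \<noteq> pv i b"
    using Cons.prems(3)[of s] Cons.prems(3)[of t] by (auto simp: pr)
  have deg: "card {i\<in>F. par i = v} + (if v = s then 1 else 0) + (if v = t then 1 else 0) \<le> 2"
    if "\<And>i b. i < l \<Longrightarrow> v \<noteq> pv i b" for v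
    using Cons.prems(4)[of v] that by (auto simp: pr split: if_splits)
  have cF: "card F + 4 * 2 ^ k \<le> c" using Cons.prems(5) by simp
  obtain F' par' ent' qs where 1: "extendable F' par' ent'" "parent_closed F' par'" "F \<subseteq> F'"
    "card F' \<le> card F + 2 * (k + 1)"
    and deg': "\<And>v. (\<And>i b. i < l \<Longrightarrow> v \<noteq> pv i b) \<Longrightarrow>
       card {i\<in>F'. par' i = v} \<le> card {i\<in>F. par i = v} + (if v = s then 1 else 0) + (if v = t then 1 else 0)"
    and qs: "linked E pv s qs t" "distinct (map fst qs)" "fst ` set qs \<subseteq> F' - F"
    using link_pair[OF Cons.prems(1,2) \<open>s \<in> X\<close> np(1) \<open>t \<in> X\<close> np(2) deg k cF] by blast
  have "\<exists>qss. length qss = length prs \<and>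
    (\<forall>a<length prs. linked E pv (fst (prs ! a)) (qss ! a) (snd (prs ! a))) \<and>
    distinct (map fst (concat qss)) \<and> fst ` set (concat qss) \<subseteq> {..<l} - F'"
  proof (rule Cons.IH[OF 1(1,2)])
    show "v \<in> X \<and> (\<forall>i<l. \<forall>b. v \<noteq> pv i b)" if "v \<in> set (map fst prs) \<union> set (map snd prs)" for v
      using Cons.prems(3)[of v] that by auto
    show "card {i\<in>F'. par' i = v} + count_list (map fst prs) v + count_list (map snd prs) v \<le> 2"
      if v: "\<And>i b. i < l \<Longrightarrow> v \<noteq> pv i b" for v
      using Cons.prems(4)[OF v] deg'[OF v] by (auto simp: pr split: if_splits)
    show "card F' + length prs * (2 * (k + 1)) + 4 * 2 ^ k \<le> c"
      using Cons.prems(5) 1(4) by simp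
  qed
  then obtain qss where qss: "length qss = length prs"
    "\<forall>a<length prs. linked E pv (fst (prs ! a)) (qss ! a) (snd (prs ! a))"
    "distinct (map fst (concat qss))" "fst ` set (concat qss) \<subseteq> {..<l} - F'" by blast
  have F'l: "F' \<subseteq> {..<l}" using 1(1) by (simp add: extendable_def)
  show ?case
  proof (intro exI[of _ "qs # qss"] conjI allI impI)
    show "linked E pv (fst ((pr # prs) ! a)) ((qs # qss) ! a) (snd ((pr # prs) ! a))"
      if "a < length (pr # prs)" for a
      using that qss(2) qs(1) by (cases a) (auto simp: pr)
    show "distinct (map fst (concat (qs # qss)))"
      using qs(2,3) qss(3,4) by auto
    show "fst ` set (concat (qs # qss)) \<subseteq> {..<l} - F"
      using qs(3) qss(4) 1(3) F'l by (simp add: image_Un) blast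
  qed (use qss in simp)
qed

end

section \<open>Assembling the Hamilton cycle\<close>

lemma path_edge_Nil [simp]: "\<not> path_edge [] p q"
  by (simp add: path_edge_def)

lemma path_edge_commute: "path_edge P u v \<Longrightarrow> path_edge P v u"
  unfolding path_edge_def insert_commute[of v u "{}"] .

lemma cycle_edge_commute: "cycle_edge cs u v \<Longrightarrow> cycle_edge cs v u"
  unfolding cycle_edge_def insert_commute[of v u "{}"] .

lemma path_edge_Cons:
  "path_edge (x # xs) p q \<longleftrightarrow> (xs \<noteq> [] \<and> {p, q} = {x, hd xs}) \<or> path_edge xs p q"
proof -
  have "path_edge (x # xs) p q \<longleftrightarrow> (\<exists>i<length xs. {p, q} = {(x # xs) ! i, xs ! i})"
    by (auto simp: path_edge_def)
  also have "\<dots> \<longleftrightarrow> (xs \<noteq> [] \<and> {p, q} = {x, hd xs}) \<or> (\<exists>i. Suc i < length xs \<and> {p, q} = {xs ! i, xs ! Suc i})"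
    (is "?l \<longleftrightarrow> ?r")
  proof
    assume ?l
    then obtain i where i: "i < length xs" "{p, q} = {(x # xs) ! i, xs ! i}" by blast
    thus ?r by (cases i) (auto simp: hd_conv_nth)
  next
    assume ?r
    thus ?l
    proof
      assume "xs \<noteq> [] \<and> {p, q} = {x, hd xs}"
      thus ?l by (intro exI[of _ 0]) (auto simp: hd_conv_nth)
    next
      assume "\<exists>i. Suc i < length xs \<and> {p, q} = {xs ! i, xs ! Suc i}"
      then obtain i where "Suc i < length xs" "{p, q} = {xs ! i, xs ! Suc i}" by blast
      thus ?l by (intro exI[of _ "Suc i"]) auto
    qed
  qed
  finally show ?thesis by (simp add: path_edge_def)
qed

lemma path_edge_append:
  "path_edge (xs @ ys) p q \<longleftrightarrow> path_edge xs p q \<or> path_edge ys p q \<or>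
     (xs \<noteq> [] \<and> ys \<noteq> [] \<and> {p, q} = {last xs, hd ys})"
  by (induction xs) (auto simp: path_edge_Cons hd_append)

lemma path_edge_split:
  assumes "path_edge P a b"
  obtains us u v vs where "P = us @ u # v # vs" "(u = a \<and> v = b) \<or> (u = b \<and> v = a)"
proof -
  from assms obtain i where i: "Suc i < length P" "{a, b} = {P ! i, P ! Suc i}"
    by (auto simp: path_edge_def)
  have "P = take i P @ P ! i # P ! Suc i # drop (Suc (Suc i)) P"
    using i(1) by (metis Cons_nth_drop_Suc Suc_lessD append_take_drop_id)
  thus thesis using i(2) by (intro that[of "take i P" "P ! i" "P ! Suc i"]) (auto simp: doubleton_eq_iff)
qed

lemma successively_path_edge: "successively (path_edge P) P"
  by (auto simp: successively_conv_nth path_edge_def)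

text \<open>A detour through \<open>R\<close> replaces the single edge between \<open>a\<close> and
  \<open>b\<close>. All other edges of the path survive, so further detours can be inserted
  later.\<close>

lemma insert_segment:
  assumes P: "distinct P" "successively H P" and e: "path_edge P a b"
    and R: "R \<noteq> []" "distinct R" "successively H R" "set R \<inter> set P = {}" "H b (hd R)" "H (last R) a"
    and sym: "\<And>u v. H u v \<Longrightarrow> H v u"
  obtains P' where "P' \<noteq> []" "distinct P'" "successively H P'" "hd P' = hd P" "last P' = last P"
    "set P' = set P \<union> set R" "\<And>p q. path_edge P p q \<Longrightarrow> {p, q} \<noteq> {a, b} \<Longrightarrow> path_edge P' p q"
proof -
  obtain us u v vs where s: "P = us @ u # v # vs" "(u = a \<and> v = b) \<or> (u = b \<and> v = a)"
    using path_edge_split[OF e] .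
  have revR: "successively H (rev R)" using R(3) sym by (simp add: successively_mono)
  \<comment> \<open>\<open>R\<close> runs from the side of \<open>b\<close> to the side of
    \<open>a\<close>, so it is reversed if the path meets \<open>a\<close> first.\<close>
  define Z where "Z = (if u = a then rev R else R)"
  have Z: "Z \<noteq> []" "distinct Z" "successively H Z" "set Z = set R"
    using R revR by (auto simp: Z_def)
  have ab: "H u (hd Z)" "H (last Z) v"
  proof -
    have "a \<noteq> b" using s P(1) by auto
    thus "H u (hd Z)" "H (last Z) v" using s(2) R sym by (auto simp: Z_def hd_rev last_rev)
  qed
  let ?P = "(us @ [u]) @ (Z @ (v # vs))"
  show thesis
  proof (rule that[of ?P])
    show "distinct ?P" using P(1) Z R(4) by (auto simp: s(1))
    show "successively H ?P" using P(2) Z(1,3) ab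
      by (auto simp: s(1) successively_append_iff successively_Cons)
    show "hd ?P = hd P" by (simp add: s(1) hd_append)
    show "last ?P = last P" by (simp add: s(1))
    show "set ?P = set P \<union> set R" using Z(4) by (auto simp: s(1))
    show "path_edge ?P p q" if "path_edge P p q" "{p, q} \<noteq> {a, b}" for p q
    proof -
      have "path_edge ((us @ [u]) @ (v # vs)) p q" using that(1) s(1) by simp
      hence "path_edge (us @ [u]) p q \<or> path_edge (v # vs) p q"
        using that(2) s(2) unfolding path_edge_append[of "us @ [u]"] by auto
      thus ?thesis unfolding path_edge_append[of "us @ [u]"] path_edge_append[of Z] by blast
    qed
  qed simp
qed

text \<open>Rotation puts the chosen edge first, and dropping its two ends leaves the path between
  the flexible vertices. For a triangle this path is a single vertex.\<close>

lemma cycle_rotation: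
  assumes cs: "is_cycle n cs" and j: "j < length cs"
  defines "R \<equiv> drop 2 (rotate j cs)" and "a \<equiv> cs ! j" and "b \<equiv> cs ! ((j + 1) mod length cs)"
  shows "R \<noteq> []" "hd R = flex_y cs j" "last R = flex_x cs j" "set cs = insert a (insert b (set R))"
    "a \<notin> set R" "b \<notin> set R" "a \<noteq> b" "distinct R" "successively (cycle_edge cs) R"
    "cycle_edge cs b (hd R)" "cycle_edge cs (last R) a"
proof -
  let ?L = "length cs"
  define rs where "rs = rotate j cs"
  have L: "?L \<ge> 3" using cs by (simp add: is_cycle_def)
  have nth: "rs ! k = cs ! ((j + k) mod ?L)" if "k < ?L" for k
    using that by (simp add: rs_def nth_rotate)
  have len: "length rs = ?L" by (simp add: rs_def)
  obtain x rs' where rs': "rs = x # rs'" using len L by (cases rs) auto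
  obtain y R' where "rs' = y # R'" using len L rs' by (cases rs') auto
  hence rs_eq: "rs = x # y # R" using rs' by (simp add: R_def rs_def[symmetric] numeral_2_eq_2)
  have "0 < ?L" using L by linarith
  from nth[OF this] have x: "x = a" using j by (simp add: rs_eq a_def)
  have y: "y = b" using nth[of 1] L by (simp add: rs_eq b_def)
  show R: "R \<noteq> []" using len L rs_eq by auto
  show hd: "hd R = flex_y cs j" using nth[of 2] L R by (simp add: rs_eq flex_y_def hd_conv_nth)
  have "last R = last rs" using R by (simp add: rs_eq)
  also have "\<dots> = rs ! (?L - 1)" using len L by (subst last_conv_nth) auto
  also have "\<dots> = flex_x cs j" using nth[of "?L - 1"] L by (simp add: flex_x_def)
  finally show "last R = flex_x cs j" .
  have "set cs = set rs" by (simp add: rs_def)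
  thus "set cs = insert a (insert b (set R))" by (simp add: rs_eq x y)
  have "distinct rs" using cs by (simp add: rs_def is_cycle_def)
  thus "a \<notin> set R" "b \<notin> set R" "a \<noteq> b" "distinct R" by (auto simp: rs_eq x y)
  have edge: "cycle_edge cs (cs ! (k mod ?L)) (cs ! (Suc k mod ?L))" for k
    unfolding cycle_edge_def using \<open>0 < ?L\<close> by (intro exI[of _ "k mod ?L"]) (auto simp: mod_Suc_eq)
  have "successively (cycle_edge cs) rs"
    unfolding successively_conv_nth using edge nth len by simp
  thus "successively (cycle_edge cs) R" "cycle_edge cs b (hd R)"
    using R by (auto simp: rs_eq successively_Cons y)
  have sj: "Suc (j + ?L - 1) = j + ?L" using L by linarith
  have "cycle_edge cs (cs ! ((j + ?L - 1) mod ?L)) (cs ! ((j + ?L) mod ?L))"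
    using edge[of "j + ?L - 1"] unfolding sj .
  thus "cycle_edge cs (last R) a"
    using j unfolding \<open>last R = flex_x cs j\<close> by (simp add: flex_x_def a_def)
qed

lemma successively_concat:
  assumes "\<And>xs. xs \<in> set xss \<Longrightarrow> xs \<noteq> [] \<and> successively H xs"
    and "successively (\<lambda>xs ys. H (last xs) (hd ys)) xss"
  shows "successively H (concat xss)"
  using assms
proof (induction xss)
  case (Cons xs xss)
  show ?case
  proof (cases xss)
    case Nil
    thus ?thesis using Cons.prems by simp
  next
    case (Cons ys yss)
    hence "hd (concat xss) = hd ys" using Cons.prems(1)[of ys] by (simp add: hd_append)
    thus ?thesis using Cons.prems Cons.IH Cons by (auto simp: successively_append_iff)
  qed
qed simp

lemma last_concat_nonempty:
  "xss \<noteq> [] \<Longrightarrow> last xss \<noteq> [] \<Longrightarrow> last (concat xss) = last (last xss)"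
  by (induction xss rule: rev_induct) auto

lemma distinct_concat_map:
  assumes "distinct xs" "\<And>x. x \<in> set xs \<Longrightarrow> distinct (f x)"
    "\<And>x y. x \<in> set xs \<Longrightarrow> y \<in> set xs \<Longrightarrow> x \<noteq> y \<Longrightarrow> set (f x) \<inter> set (f y) = {}"
  shows "distinct (concat (map f xs))"
  using assms by (induction xs) auto

lemma mset_concat_map_append:
  "mset (concat (map (\<lambda>x. f x @ g x) xs)) = mset (concat (map f xs)) + mset (concat (map g xs))"
  by (induction xs) auto

section \<open>Cycles attached to the first path\<close>

definition port :: "nat list list \<Rightarrow> nat list \<Rightarrow> nat \<Rightarrow> bool \<Rightarrow> nat" where
  "port Cs js i b = (if b then flex_x (Cs ! i) (js ! i) else flex_y (Cs ! i) (js ! i))"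

lemma flex_set_eq: "flex_set Cs js = (\<Union>i<length Cs. range (port Cs js i))"
  unfolding flex_set_def port_def by (auto split: if_splits)

text \<open>This is the purely combinatorial part of goodness, without the degree conditions; it is
  all that assembling the cycle from given links requires.\<close>

locale connected_cycles =
  fixes n :: nat and E :: "nat \<Rightarrow> nat \<Rightarrow> bool" and Ps Cs :: "nat list list" and js :: "nat list"
  assumes E_sym: "E u v \<Longrightarrow> E v u"
    and Ps_ne: "Ps \<noteq> []"
    and paths: "P \<in> set Ps \<Longrightarrow> is_path n P"
    and paths_disj: "pairwise_disjoint_lists Ps"
    and cycles: "C \<in> set Cs \<Longrightarrow> is_cycle n C"
    and cycles_disj: "pairwise_disjoint_lists Cs"
    and tl_disj: "C \<in> set Cs \<Longrightarrow> P \<in> set (tl Ps) \<Longrightarrow> set C \<inter> set P = {}"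
    and cover: "(\<Union>P \<in> set Ps. set P) \<union> (\<Union>C \<in> set Cs. set C) = {0..<n}"
    and connects: "connects_via (hd Ps) Cs js"
begin

abbreviation "H \<equiv> union_graph E Ps Cs"

text \<open>In the notation of the opening overview these are \<open>a\<^sub>i\<close>,
  \<open>b\<^sub>i\<close> and the path \<open>Q\<^sub>i\<close>, which runs from the port
  \<open>False\<close> to the port \<open>True\<close>.\<close>

definition "ea i = Cs ! i ! (js ! i)"
definition "eb i = Cs ! i ! ((js ! i + 1) mod length (Cs ! i))"
definition "rest i = drop 2 (rotate (js ! i) (Cs ! i))"

text \<open>The flag names the port of entry. Entering at the port \<open>True\<close>, the last
  vertex of \<open>rest\<close>, means walking backwards.\<close>

definition segment :: "nat \<times> bool \<Rightarrow> nat list" where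
  "segment p = (if snd p then rev (rest (fst p)) else rest (fst p))"

lemma H_sym: "H u v \<Longrightarrow> H v u"
  using E_sym path_edge_commute cycle_edge_commute unfolding union_graph_def by blast

lemma rest_props:
  assumes i: "i < length Cs"
  shows "rest i \<noteq> []" "hd (rest i) = port Cs js i False" "last (rest i) = port Cs js i True"
    "set (Cs ! i) = insert (ea i) (insert (eb i) (set (rest i)))"
    "distinct (rest i)" "successively H (rest i)" "H (eb i) (hd (rest i))" "H (last (rest i)) (ea i)"
    "path_edge (hd Ps) (ea i) (eb i)" "set (hd Ps) \<inter> set (rest i) = {}"
    "ea i \<in> set (hd Ps)" "eb i \<in> set (hd Ps)" "ea i \<in> set (Cs ! i)"
proof -
  have C: "is_cycle n (Cs ! i)" and ji: "js ! i < length (Cs ! i)"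
    and pe: "path_edge (hd Ps) (ea i) (eb i)" and int: "set (hd Ps) \<inter> set (Cs ! i) = {ea i, eb i}"
    using i cycles connects by (auto simp: connects_via_def ea_def eb_def)
  note rot = cycle_rotation[OF C ji, folded rest_def ea_def eb_def]
  have HC: "cycle_edge (Cs ! i) u v \<Longrightarrow> H u v" for u v
    using i by (auto simp: union_graph_def)
  show "rest i \<noteq> []" "distinct (rest i)" by fact+
  show "hd (rest i) = port Cs js i False" "last (rest i) = port Cs js i True"
    using rot by (auto simp: port_def)
  show s: "set (Cs ! i) = insert (ea i) (insert (eb i) (set (rest i)))" by fact
  show "successively H (rest i)" using rot(9) HC by (rule successively_mono)
  show "H (eb i) (hd (rest i))" "H (last (rest i)) (ea i)" using rot HC by auto
  show "path_edge (hd Ps) (ea i) (eb i)" by fact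
  show "set (hd Ps) \<inter> set (rest i) = {}"
  proof (rule ccontr)
    assume "set (hd Ps) \<inter> set (rest i) \<noteq> {}"
    then obtain x where x: "x \<in> set (hd Ps)" "x \<in> set (rest i)" by auto
    hence "x \<in> set (hd Ps) \<inter> set (Cs ! i)" using s by simp
    thus False unfolding int using x(2) rot(5,6) by auto
  qed
  show "ea i \<in> set (hd Ps)" "eb i \<in> set (hd Ps)" using int by auto
  show "ea i \<in> set (Cs ! i)" using s by simp
qed

lemma cycle_disj:
  "i < length Cs \<Longrightarrow> k < length Cs \<Longrightarrow> i \<noteq> k \<Longrightarrow> set (Cs ! i) \<inter> set (Cs ! k) = {}"
  using cycles_disj by (auto simp: pairwise_disjoint_lists_def)

lemma rest_subset: "i < length Cs \<Longrightarrow> set (rest i) \<subseteq> set (Cs ! i)"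
  by (subst rest_props(4)) auto

lemma rest_disj:
  "i < length Cs \<Longrightarrow> k < length Cs \<Longrightarrow> i \<noteq> k \<Longrightarrow> set (rest i) \<inter> set (rest k) = {}"
  using cycle_disj[of i k] rest_subset[of i] rest_subset[of k] by blast

lemma path_rest_disj:
  assumes "P \<in> set Ps" "i < length Cs"
  shows "set P \<inter> set (rest i) = {}"
proof (cases "P = hd Ps")
  case False
  hence "P \<in> set (tl Ps)" using assms(1) Ps_ne by (metis list.collapse set_ConsD)
  from tl_disj[OF nth_mem[OF assms(2)] this] show ?thesis using rest_subset[OF assms(2)] by blast
qed (use rest_props(10) assms in simp)

lemma port_in_rest: "i < length Cs \<Longrightarrow> port Cs js i b \<in> set (rest i)"
  using rest_props(1-3)[of i] hd_in_set[of "rest i"] last_in_set[of "rest i"] by (cases b) auto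

lemma port_eqD:
  "i < length Cs \<Longrightarrow> k < length Cs \<Longrightarrow> port Cs js i b = port Cs js k b' \<Longrightarrow> i = k"
  using port_in_rest[of i b] port_in_rest[of k b'] rest_disj[of i k] by auto

text \<open>Detours are inserted one cycle at a time. The induction carries along that the chosen
  edge of every cycle not yet absorbed is still on the path; it survives because chosen edges of
  disjoint cycles differ.\<close>

lemma absorb_cycles:
  assumes "U \<subseteq> {..<length Cs}"
  obtains P' where "P' \<noteq> []" "distinct P'" "successively H P'" "hd P' = hd (hd Ps)" "last P' = last (hd Ps)"
    "set P' = set (hd Ps) \<union> (\<Union>i\<in>U. set (rest i))"
proof -
  have "finite U" using assms finite_subset by blast
  hence "\<exists>P'. P' \<noteq> [] \<and> distinct P' \<and> successively H P' \<and> hd P' = hd (hd Ps) \<and> last P' = last (hd Ps) \<and>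
    set P' = set (hd Ps) \<union> (\<Union>i\<in>U. set (rest i)) \<and>
    (\<forall>i<length Cs. i \<notin> U \<longrightarrow> path_edge P' (ea i) (eb i))"
    using assms
  proof (induction U)
    case empty
    have hd: "hd Ps \<in> set Ps" using Ps_ne by simp
    have "successively H (hd Ps)"
      by (rule successively_mono[OF successively_path_edge]) (use hd in \<open>auto simp: union_graph_def\<close>)
    thus ?case using paths[OF hd] rest_props(9) by (intro exI[of _ "hd Ps"]) (auto simp: is_path_def)
  next
    case (insert i U)
    then obtain P' where P': "P' \<noteq> []" "distinct P'" "successively H P'" "hd P' = hd (hd Ps)"
      "last P' = last (hd Ps)" "set P' = set (hd Ps) \<union> (\<Union>i\<in>U. set (rest i))"
      "\<forall>i<length Cs. i \<notin> U \<longrightarrow> path_edge P' (ea i) (eb i)" by auto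
    have i: "i < length Cs" using insert.prems by simp
    have e: "path_edge P' (ea i) (eb i)" using P'(7) i insert.hyps(2) by blast
    have disj: "set (rest i) \<inter> set P' = {}"
    proof -
      have "set (rest i) \<inter> set (rest k) = {}" if "k \<in> U" for k
        using rest_disj[OF i, of k] that insert by auto
      thus ?thesis using rest_props(10)[OF i] unfolding P'(6) by auto
    qed
    obtain P'' where P'': "P'' \<noteq> []" "distinct P''" "successively H P''" "hd P'' = hd P'" "last P'' = last P'"
      "set P'' = set P' \<union> set (rest i)"
      "\<And>p q. path_edge P' p q \<Longrightarrow> {p, q} \<noteq> {ea i, eb i} \<Longrightarrow> path_edge P'' p q"
      using insert_segment[where H = H, OF P'(2,3) e rest_props(1,5,6)[OF i] disj rest_props(7,8)[OF i]] H_sym by blast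
    have "path_edge P'' (ea k) (eb k)" if k: "k < length Cs" "k \<notin> insert i U" for k
    proof (rule P''(7))
      show "path_edge P' (ea k) (eb k)" using P'(7) k by blast
      have "ea k \<notin> set (Cs ! i)" using cycle_disj[OF k(1) i] rest_props(13)[OF k(1)] k(2) by auto
      moreover have "{ea i, eb i} \<subseteq> set (Cs ! i)" using rest_props(4)[OF i] by auto
      ultimately show "{ea k, eb k} \<noteq> {ea i, eb i}" by blast
    qed
    thus ?case using P' P'' by (intro exI[of _ P'']) auto
  qed
  thus thesis using that by blast
qed

lemma segment_props:
  assumes "i < length Cs"
  shows "segment (i, b) \<noteq> []" "hd (segment (i, b)) = port Cs js i b" "last (segment (i, b)) = port Cs js i (\<not> b)"
    "set (segment (i, b)) = set (rest i)" "distinct (segment (i, b))" "successively H (segment (i, b))"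
proof -
  note r = rest_props[OF assms]
  show "segment (i, b) \<noteq> []" "hd (segment (i, b)) = port Cs js i b" "last (segment (i, b)) = port Cs js i (\<not> b)"
    "set (segment (i, b)) = set (rest i)" "distinct (segment (i, b))"
    using r by (auto simp: segment_def hd_rev last_rev)
  show "successively H (segment (i, b))"
    using r(6) H_sym by (auto simp: segment_def successively_mono)
qed

text \<open>The cycle is \<open>A 0, B 0, A 1, B 1, ...\<close>: each path \<open>A j\<close> is
  followed by the link \<open>B j\<close> to the next one. The path \<open>A 0\<close> has absorbed
  every cycle that no link crosses, so each \<open>rest i\<close> is covered exactly once.\<close>

lemma hamilton_cycle_of_links:
  assumes n: "n \<ge> 3" and len: "length qss = length Ps"
    and links: "\<And>j. j < length Ps \<Longrightarrow>
       linked E (port Cs js) (last (Ps ! j)) (qss ! j) (hd (Ps ! (Suc j mod length Ps)))"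
    and dist: "distinct (map fst (concat qss))" and bound: "fst ` set (concat qss) \<subseteq> {..<length Cs}"
  shows "\<exists>hs. hamilton_cycle n H hs"
proof -
  let ?r = "length Ps"
  let ?W = "fst ` set (concat qss)"
  have r: "?r > 0" using Ps_ne by simp
  obtain P' where P': "P' \<noteq> []" "distinct P'" "successively H P'" "hd P' = hd (hd Ps)" "last P' = last (hd Ps)"
    "set P' = set (hd Ps) \<union> (\<Union>i\<in>{..<length Cs} - ?W. set (rest i))"
    using absorb_cycles[of "{..<length Cs} - ?W"] by auto
  define A where "A j = (if j = 0 then P' else Ps ! j)" for j
  define B where "B j = concat (map segment (qss ! j))" for j
  define hs where "hs = concat (map (\<lambda>j. A j @ B j) [0..<?r])"
  have A: "A j \<noteq> []" "distinct (A j)" "successively H (A j)" "hd (A j) = hd (Ps ! j)" "last (A j) = last (Ps ! j)"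
    if j: "j < ?r" for j
  proof -
    have mem: "Ps ! j \<in> set Ps" using j by simp
    have "successively H (Ps ! j)"
      by (rule successively_mono[OF successively_path_edge]) (use mem in \<open>auto simp: union_graph_def\<close>)
    thus "A j \<noteq> []" "distinct (A j)" "successively H (A j)" "hd (A j) = hd (Ps ! j)" "last (A j) = last (Ps ! j)"
      using P' paths[OF mem] Ps_ne by (auto simp: A_def is_path_def hd_conv_nth)
  qed
  have setA: "set (A j) \<subseteq> set (Ps ! j) \<union> (\<Union>i\<in>{..<length Cs} - ?W. set (rest i))" if "j < ?r" for j
    using P'(6) Ps_ne by (auto simp: A_def hd_conv_nth)
  have qs: "fst p < length Cs" if "j < ?r" "p \<in> set (qss ! j)" for j p
  proof -
    have "qss ! j \<in> set qss" using that len by simp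
    hence "p \<in> set (concat qss)" using that(2) by auto
    thus ?thesis using bound by auto
  qed
  have seg: "segment p \<noteq> []" "hd (segment p) = port Cs js (fst p) (snd p)"
    "last (segment p) = port Cs js (fst p) (\<not> snd p)" "set (segment p) = set (rest (fst p))"
    "distinct (segment p)" "successively H (segment p)" if "fst p < length Cs" for p
    using segment_props[OF that, of "snd p"] by auto
  have E_H: "E u v \<Longrightarrow> H u v" for u v by (simp add: union_graph_def)
  have B: "B j \<noteq> []" "successively H (B j)" "H (last (A j)) (hd (B j))" "H (last (B j)) (hd (A (Suc j mod ?r)))"
    if j: "j < ?r" for j
  proof -
    have lk: "qss ! j \<noteq> []" "E (last (Ps ! j)) (port Cs js (fst (hd (qss ! j))) (snd (hd (qss ! j))))"
      "successively (\<lambda>p q. E (port Cs js (fst p) (\<not> snd p)) (port Cs js (fst q) (snd q))) (qss ! j)"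
      "E (port Cs js (fst (last (qss ! j))) (\<not> snd (last (qss ! j)))) (hd (Ps ! (Suc j mod ?r)))"
      using links[OF j] by (auto simp: linked_def)
    have hdq: "fst (hd (qss ! j)) < length Cs" "fst (last (qss ! j)) < length Cs" using qs[OF j] lk(1) by auto
    have "hd (B j) = hd (segment (hd (qss ! j)))"
      using lk(1) seg(1)[OF hdq(1)] by (cases "qss ! j") (auto simp: B_def hd_append)
    thus "H (last (A j)) (hd (B j))" using lk(2) A(5)[OF j] seg(2)[OF hdq(1)] E_H by simp
    have "last (B j) = last (segment (last (qss ! j)))"
      using lk(1) seg(1)[OF hdq(2)] by (simp add: B_def last_concat_nonempty last_map)
    moreover have "Suc j mod ?r < ?r" using r by simp
    ultimately show "H (last (B j)) (hd (A (Suc j mod ?r)))"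
      using lk(4) A(4) seg(3)[OF hdq(2)] E_H by simp
    show "successively H (B j)" unfolding B_def
    proof (rule successively_concat)
      show "successively (\<lambda>xs ys. H (last xs) (hd ys)) (map segment (qss ! j))"
        unfolding successively_map
        by (rule successively_mono[OF lk(3)]) (use seg qs[OF j] E_H in auto)
    qed (use seg qs[OF j] in auto)
    show "B j \<noteq> []" using lk(1) seg(1)[OF hdq(1)] by (cases "qss ! j") (auto simp: B_def)
  qed
  have AB: "A j @ B j \<noteq> [] \<and> successively H (A j @ B j)" if "j < ?r" for j
    using A[OF that] B[OF that] by (simp add: successively_append_iff)
  have path: "successively H hs" unfolding hs_def
  proof (rule successively_concat)
    show "successively (\<lambda>xs ys. H (last xs) (hd ys)) (map (\<lambda>j. A j @ B j) [0..<?r])"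
      unfolding successively_conv_nth
    proof (intro allI impI)
      fix j assume "Suc j < length (map (\<lambda>j. A j @ B j) [0..<?r])"
      hence j: "Suc j < ?r" by simp
      thus "H (last (map (\<lambda>j. A j @ B j) [0..<?r] ! j)) (hd (map (\<lambda>j. A j @ B j) [0..<?r] ! Suc j))"
        using B(1)[of j] B(4)[of j] A(1)[OF j] by simp
    qed
  qed (use AB in auto)
  have hd_hs: "hd hs = hd (A 0)"
    using A(1)[OF r] r by (simp add: hs_def upt_conv_Cons hd_append)
  have last_hs: "last hs = last (B (?r - 1))"
  proof -
    have "last (map (\<lambda>j. A j @ B j) [0..<?r]) = A (?r - 1) @ B (?r - 1)"
      using r by (simp add: last_map)
    thus ?thesis using B(1)[of "?r - 1"] r unfolding hs_def by (subst last_concat_nonempty) auto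
  qed
  have close: "H (last hs) (hd hs)"
    using B(4)[of "?r - 1"] r unfolding hd_hs last_hs by simp
  have concatB: "concat (map B [0..<?r]) = concat (map segment (concat qss))"
  proof -
    have "map B [0..<?r] = map (\<lambda>qs. concat (map segment qs)) (map ((!) qss) [0..<?r])"
      by (simp add: B_def)
    also have "map ((!) qss) [0..<?r] = qss" using len map_nth by metis
    finally have "concat (map B [0..<?r]) = concat (map (\<lambda>qs. concat (map segment qs)) qss)" by simp
    also have "\<dots> = concat (map segment (concat qss))" by (induction qss) auto
    finally show ?thesis .
  qed
  have bnd: "fst p < length Cs" if "p \<in> set (concat qss)" for p
    using subsetD[OF bound imageI[OF that]] by simp
  have hd0: "hd Ps = Ps ! 0" using Ps_ne by (simp add: hd_conv_nth)
  have set_nth: "set xs = (!) xs ` {0..<length xs}" for xs :: "nat list list"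
    using nth_image[of "length xs" xs] by simp
  have setAll: "set (concat (map A [0..<?r])) = (\<Union>P\<in>set Ps. set P) \<union> (\<Union>i\<in>{..<length Cs} - ?W. set (rest i))"
  proof -
    have "set (concat (map A [0..<?r])) = (\<Union>j\<in>{0..<?r}. set (A j))" by simp
    also have "{0..<?r} = insert 0 {1..<?r}" using r by auto
    also have "(\<Union>j\<in>insert 0 {1..<?r}. set (A j)) = set P' \<union> (\<Union>j\<in>{1..<?r}. set (Ps ! j))"
      by (simp add: A_def)
    also have "\<dots> = (\<Union>j\<in>insert 0 {1..<?r}. set (Ps ! j)) \<union> (\<Union>i\<in>{..<length Cs} - ?W. set (rest i))"
      unfolding P'(6) hd0 by blast
    also have "insert 0 {1..<?r} = {0..<?r}" using r by auto
    also have "(\<Union>j\<in>{0..<?r}. set (Ps ! j)) = (\<Union>P\<in>set Ps. set P)"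
      unfolding set_nth by simp
    finally show ?thesis .
  qed
  have setB: "set (concat (map segment (concat qss))) = (\<Union>i\<in>?W. set (rest i))"
  proof -
    have "set (concat (map segment (concat qss))) = (\<Union>p\<in>set (concat qss). set (segment p))" by simp
    also have "\<dots> = (\<Union>p\<in>set (concat qss). set (rest (fst p)))"
      by (intro SUP_cong refl seg(4) bnd)
    also have "\<dots> = (\<Union>i\<in>?W. set (rest i))" by (simp only: image_image)
    finally show ?thesis .
  qed
  have dA: "distinct (concat (map A [0..<?r]))"
  proof (rule distinct_concat_map)
    fix j k assume jk: "j \<in> set [0..<?r]" "k \<in> set [0..<?r]" "j \<noteq> k"
    have disjP: "set (Ps ! j) \<inter> set (Ps ! k) = {}"
      using paths_disj jk by (auto simp: pairwise_disjoint_lists_def)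
    have pr: "set (Ps ! a) \<inter> set (rest i) = {}" if "a < ?r" "i < length Cs" for a i
      using path_rest_disj[of "Ps ! a" i] that by simp
    have pr': "set (Ps ! a) \<inter> (\<Union>i\<in>{..<length Cs} - ?W. set (rest i)) = {}" if "a < ?r" for a
      using pr[OF that] by blast
    have jr: "j < ?r" "k < ?r" using jk by auto
    show "set (A j) \<inter> set (A k) = {}"
    proof (cases "j = 0")
      case True
      hence Ak: "set (A k) = set (Ps ! k)" using jk by (simp add: A_def)
      show ?thesis unfolding Ak using setA[OF jr(1)] disjP pr'[OF jr(2)] by blast
    next
      case False
      hence Aj: "set (A j) = set (Ps ! j)" by (simp add: A_def)
      show ?thesis unfolding Aj using setA[OF jr(2)] disjP pr'[OF jr(1)] by blast
    qed
  qed (use A(2) in auto)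
  have dB: "distinct (concat (map segment (concat qss)))"
  proof (rule distinct_concat_map)
    show "distinct (concat qss)" using dist by (simp add: distinct_map)
    show "distinct (segment p)" if "p \<in> set (concat qss)" for p using seg(5)[OF bnd[OF that]] .
    fix p q assume pq: "p \<in> set (concat qss)" "q \<in> set (concat qss)" "p \<noteq> q"
    have "fst p \<noteq> fst q" using dist pq unfolding distinct_map inj_on_def by blast
    moreover have "fst p < length Cs" "fst q < length Cs" using bnd pq by blast+
    ultimately show "set (segment p) \<inter> set (segment q) = {}"
      using rest_disj seg(4) by simp
  qed
  \<comment> \<open>Distinctness and the vertex set do not depend on the order, so they can be read
    off with all paths listed before all links.\<close>
  have ms: "mset hs = mset (concat (map A [0..<?r]) @ concat (map segment (concat qss)))"
    unfolding hs_def mset_concat_map_append concatB by simp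
  have "set (concat (map A [0..<?r])) \<inter> set (concat (map segment (concat qss))) = {}"
  proof -
    have "set P \<inter> set (rest i) = {}" if "P \<in> set Ps" "i \<in> ?W" for P i
      using path_rest_disj that bound by blast
    moreover have "set (rest k) \<inter> set (rest i) = {}" if "k \<in> {..<length Cs} - ?W" "i \<in> ?W" for k i
      using rest_disj that bound by blast
    ultimately show ?thesis unfolding setAll setB by blast
  qed
  hence dist_hs: "distinct hs"
    using mset_eq_imp_distinct_iff[OF ms] dA dB by simp
  have set_hs: "set hs = {0..<n}"
  proof -
    have "set hs = set (concat (map A [0..<?r])) \<union> set (concat (map segment (concat qss)))"
      using mset_eq_setD[OF ms] by simp
    also have "\<dots> = (\<Union>P\<in>set Ps. set P) \<union> (\<Union>i\<in>{..<length Cs}. set (rest i))"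
      unfolding setAll setB using bound by blast
    \<comment> \<open>The two vertices of a cycle outside \<open>rest i\<close> are ends of its
      chosen edge and lie on the first path already.\<close>
    also have "\<dots> = (\<Union>P\<in>set Ps. set P) \<union> (\<Union>i\<in>{..<length Cs}. set (Cs ! i))"
    proof -
      have "set (Cs ! i) = insert (ea i) (insert (eb i) (set (rest i)))" "ea i \<in> set (hd Ps)" "eb i \<in> set (hd Ps)"
        if "i < length Cs" for i using rest_props[OF that] by auto
      thus ?thesis using Ps_ne by fastforce
    qed
    also have "(\<Union>i\<in>{..<length Cs}. set (Cs ! i)) = (\<Union>C\<in>set Cs. set C)"
      unfolding set_nth[of Cs] by (simp add: atLeast0LessThan)
    finally show ?thesis using cover by simp
  qed
  have len_hs: "length hs = n" using distinct_card[OF dist_hs] set_hs by simp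
  have "H (hs ! i) (hs ! ((i + 1) mod length hs))" if "i < length hs" for i
  proof (cases "Suc i < length hs")
    case True
    thus ?thesis using path by (simp add: successively_conv_nth)
  next
    case False
    hence "i = length hs - 1" using that by simp
    moreover have "hs \<noteq> []" using that by auto
    ultimately show ?thesis using close by (simp add: last_conv_nth hd_conv_nth)
  qed
  thus ?thesis using n dist_hs set_hs len_hs by (auto simp: hamilton_cycle_def)
qed

end

section \<open>Links in pseudorandom graphs\<close>

lemma count_list_le_1_if_distinct: "distinct xs \<Longrightarrow> count_list xs v \<le> 1"
  by (induction xs) auto

text \<open>With no edges the mixing lemma reads \<open>d * p / n \<le> lam * sqrt p\<close>, where
  \<open>p\<close> is the product of the sizes; cancelling \<open>sqrt p\<close> gives the
  bound.\<close>

lemma no_edges_card_bound: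
  fixes E :: "nat \<Rightarrow> nat \<Rightarrow> bool"
  assumes G: "ndl_graph n d lam E" and n: "n \<ge> 2" and d: "d > 0"
    and S: "S \<subseteq> {..<n}" and T: "T \<subseteq> {..<n}" and no: "\<And>s t. s \<in> S \<Longrightarrow> t \<in> T \<Longrightarrow> \<not> E s t"
  shows "real (card S) * real (card T) \<le> (lam * real n / real d)\<^sup>2"
proof -
  let ?p = "real (card S) * real (card T)"
  have "real (card {t\<in>T. E s t}) = 0" if "s \<in> S" for s
  proof -
    have "{t\<in>T. E s t} = {}" using no that by blast
    thus ?thesis by (simp only: card.empty of_nat_0)
  qed
  hence "(\<Sum>s\<in>S. real (card {t\<in>T. E s t})) = 0" by simp
  with expander_mixing[OF G n S T] have "real d * ?p / real n \<le> lam * sqrt ?p"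
    by (simp add: mult.assoc)
  hence "?p \<le> (lam * real n / real d) * sqrt ?p"
    using d n by (simp add: field_simps)
  hence "sqrt ?p * sqrt ?p \<le> (lam * real n / real d) * sqrt ?p" by simp
  hence "?p = 0 \<or> sqrt ?p \<le> lam * real n / real d"
    by (metis mult_right_le_imp_le le_less real_sqrt_gt_zero mult_nonneg_nonneg of_nat_0_le_iff)
  thus ?thesis
  proof
    assume "sqrt ?p \<le> lam * real n / real d"
    hence "(sqrt ?p)\<^sup>2 \<le> (lam * real n / real d)\<^sup>2" by (intro power_mono) auto
    thus ?thesis by simp
  next
    assume "?p = 0"
    thus ?thesis by (simp only: zero_le_power2)
  qed
qed

lemma exists_power_two_between:
  assumes "m \<ge> (1::nat)"
  obtains k where "m \<le> 2 ^ k" "2 ^ k < 2 * m"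
proof -
  have "\<exists>k. m \<le> 2 ^ k" using less_exp[of m] by (metis less_imp_le)
  define k where "k = (LEAST k. m \<le> 2 ^ k)"
  have k: "m \<le> 2 ^ k" unfolding k_def using \<open>\<exists>k. m \<le> 2 ^ k\<close> by (rule LeastI_ex)
  have "2 ^ k < 2 * m"
  proof (cases k)
    case 0
    thus ?thesis using assms by simp
  next
    case (Suc k')
    hence "\<not> m \<le> 2 ^ k'" unfolding k_def using not_less_Least[of k' "\<lambda>k. m \<le> 2 ^ k"] by simp
    thus ?thesis using Suc by simp
  qed
  with k show thesis by (rule that)
qed

text \<open>This bounds the cost of one link. From \<open>ln 2 \<ge> 1 / 2\<close> follows
  \<open>k \<le> 2 * ln n + 1\<close>, and \<open>ln n \<ge> 1\<close> absorbs the
  constants.\<close>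

lemma chain_length_bound:
  assumes k: "(2::nat) ^ k < 2 * n" and n: "n \<ge> 3"
  shows "2 * (real k + 1) \<le> 8 * ln (real n)"
proof -
  have "exp (1::real) \<le> 3" by (rule exp_le)
  hence ln1: "1 \<le> ln (real n)" using n by (subst ln_ge_iff) auto
  have "(2::real) ^ k \<le> 2 * real n"
    using k by (metis less_imp_le of_nat_le_iff of_nat_mult of_nat_numeral of_nat_power)
  hence "ln ((2::real) ^ k) \<le> ln (2 * real n)" using n by (subst ln_le_cancel_iff) auto
  hence le: "real k * ln 2 \<le> ln 2 + ln (real n)" using n by (simp add: ln_realpow ln_mult)
  have "(1::real) \<le> ln (2 * 2)" using \<open>exp (1::real) \<le> 3\<close> by (subst ln_ge_iff) auto
  hence ln2: "(1::real) / 2 \<le> ln 2" by (subst (asm) ln_mult) auto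
  have "1 / 2 * (real k - 1) \<le> ln (real n)"
  proof (cases "real k \<ge> 1")
    case True
    have "1 / 2 * (real k - 1) \<le> ln 2 * (real k - 1)"
      using True ln2 by (intro mult_right_mono) auto
    also have "\<dots> \<le> ln (real n)" using le by (simp add: algebra_simps)
    finally show ?thesis .
  next
    case False
    thus ?thesis using ln1 by simp
  qed
  thus ?thesis using ln1 by simp
qed

text \<open>Small sets expand by the minimum degree and the mixing lemma; large sets expand and are
  joined by the bound for edge-free pairs. Half of the cycles is reserved as the budget
  \<open>c\<close>.\<close>

lemma port_expander_of_flexible_ports:
  fixes E :: "nat \<Rightarrow> nat \<Rightarrow> bool" and lam :: real
  defines "X' Ps Cs js \<equiv> flex_set Cs js \<union> hd ` set Ps \<union> last ` set Ps"
  assumes G: "ndl_graph n d lam E" and n: "n \<ge> 2" and d: "d > 0"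
    and cc: "connected_cycles n E Ps Cs js"
    and q: "lam * real n / real d \<ge> 1" and l: "real (length Cs) \<ge> 2000 * (lam * real n / real d)"
    and m: "real m > lam * real n / real d" "real m \<le> lam * real n / real d + 1"
    and deg: "\<And>v. v \<in> X' Ps Cs js \<Longrightarrow> real (card {u \<in> flex_set Cs js. E v u}) \<ge> 500 * lam"
  shows "port_expander E (port Cs js) (X' Ps Cs js) (length Cs) m (length Cs div 2)"
proof -
  interpret connected_cycles n E Ps Cs js by (rule cc)
  let ?q = "lam * real n / real d" and ?V = "flex_set Cs js" and ?X = "X' Ps Cs js"
  let ?N = "\<lambda>S. {i. i < length Cs \<and> (\<exists>b. \<exists>s\<in>S. E s (port Cs js i b))}"
  have lam: "lam > 0"
  proof (rule ccontr)
    assume "\<not> lam > 0"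
    hence "?q \<le> 0" by (intro divide_nonpos_nonneg mult_nonpos_nonneg) auto
    thus False using q by linarith
  qed
  have mq: "real m \<le> 2 * ?q" using m(2) q by simp
  have portV: "port Cs js i b \<in> ?V" if "i < length Cs" for i b
    using that by (auto simp: flex_set_eq)
  have Vn: "?V \<subseteq> {..<n}"
  proof
    fix v assume "v \<in> ?V"
    then obtain i b where i: "i < length Cs" "v = port Cs js i b" by (auto simp: flex_set_eq)
    have "v \<in> set (Cs ! i)" using port_in_rest[OF i(1)] rest_subset[OF i(1)] i(2) by auto
    moreover have "is_cycle n (Cs ! i)" using i(1) cycles by simp
    ultimately show "v \<in> {..<n}" by (auto simp: is_cycle_def)
  qed
  have Xn: "?X \<subseteq> {..<n}"
  proof -
    have "hd P < n \<and> last P < n" if "P \<in> set Ps" for P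
    proof -
      have "hd P \<in> set P" "last P \<in> set P" "set P \<subseteq> {0..<n}"
        using paths[OF that] by (auto simp: is_path_def)
      thus ?thesis by auto
    qed
    thus ?thesis using Vn by (auto simp: X'_def)
  qed
  have fV: "finite ?V" using Vn finite_subset by blast
  show ?thesis
  proof
    show "finite ?X" using Xn finite_subset by blast
    show "port Cs js i b \<in> ?X" if "i < length Cs" for i b
      using portV[OF that] by (simp add: X'_def)
    show "m \<ge> 1" using m(1) q by simp
    show "2 * card S \<le> card (?N S)" if S: "S \<subseteq> ?X" "card S \<le> 2 * m" for S
    proof (rule ccontr)
      assume neg: "\<not> ?thesis"
      \<comment> \<open>An index owns at most two ports, so failure of expansion gives
        \<open>card T \<le> 4 * card S\<close>. By mixing, at most \<open>18 * lam * card S\<close>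
        edges then run from \<open>S\<close> to \<open>T\<close>: 16 from the density term, as
        \<open>card S \<le> 4 * ?q\<close>, and 2 from the error term. The degree condition demands
        500.\<close>
      define T where "T = {v\<in>?V. \<exists>s\<in>S. E s v}"
      have Tn: "T \<subseteq> {..<n}" using Vn by (auto simp: T_def)
      have Sn: "S \<subseteq> {..<n}" using S(1) Xn by blast
      have "T \<subseteq> (\<lambda>i. port Cs js i True) ` ?N S \<union> (\<lambda>i. port Cs js i False) ` ?N S"
      proof
        fix v assume "v \<in> T"
        then obtain i b where "i < length Cs" "v = port Cs js i b" "\<exists>s\<in>S. E s v"
          by (auto simp: T_def flex_set_eq)
        thus "v \<in> (\<lambda>i. port Cs js i True) ` ?N S \<union> (\<lambda>i. port Cs js i False) ` ?N S"
          by (cases b) auto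
      qed
      hence "card T \<le> card ((\<lambda>i. port Cs js i True) ` ?N S \<union> (\<lambda>i. port Cs js i False) ` ?N S)"
        by (intro card_mono) auto
      also have "\<dots> \<le> card (?N S) + card (?N S)"
        by (intro order_trans[OF card_Un_le] add_mono card_image_le) auto
      finally have T4: "real (card T) \<le> 4 * real (card S)" and S0: "card S > 0" using neg by linarith+
      have "500 * lam * real (card S) \<le> (\<Sum>s\<in>S. real (card {t\<in>T. E s t}))"
      proof -
        have "500 * lam \<le> real (card {t\<in>T. E s t})" if s: "s \<in> S" for s
        proof -
          have "{t\<in>T. E s t} = {u\<in>?V. E s u}" using s by (auto simp: T_def)
          thus ?thesis using deg[of s] s S(1) by auto
        qed
        from sum_mono[of S "\<lambda>_. 500 * lam", OF this] show ?thesis by (simp add: mult.commute)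
      qed
      also have "\<dots> \<le> real d * real (card S) * real (card T) / real n + lam * sqrt (real (card S) * real (card T))"
        using expander_mixing[OF G n Sn Tn] by linarith
      also have "\<dots> \<le> 16 * lam * real (card S) + lam * (2 * real (card S))"
      proof (intro add_mono mult_left_mono)
        have "real d * real (card S) * real (card T) / real n \<le> real d * real (card S) * (4 * (4 * ?q)) / real n"
        proof -
          have "real (card S) \<le> 4 * ?q" using S(2) mq by linarith
          hence "real (card T) \<le> 4 * (4 * ?q)" using T4 by linarith
          thus ?thesis by (intro divide_right_mono mult_left_mono) auto
        qed
        also have "\<dots> = 16 * lam * real (card S)" using d n by (simp add: field_simps)
        finally show "real d * real (card S) * real (card T) / real n \<le> 16 * lam * real (card S)" .
        have "real (card S) * real (card T) \<le> real (card S) * (4 * real (card S))"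
          using T4 by (intro mult_left_mono) auto
        hence "real (card S) * real (card T) \<le> (2 * real (card S))\<^sup>2" by (simp add: power2_eq_square)
        thus "sqrt (real (card S) * real (card T)) \<le> 2 * real (card S)" by (intro real_le_lsqrt) auto
      qed (use lam in auto)
      finally have "482 * (lam * real (card S)) \<le> 0" by (simp add: algebra_simps)
      moreover have "lam * real (card S) > 0" using lam S0 by simp
      ultimately show False by linarith
    qed
    show "4 * m + length Cs div 2 < card (?N S)" if S: "S \<subseteq> ?X" "m \<le> card S" for S
    proof -
      \<comment> \<open>Each missed index contributes its own port to \<open>Z\<close>, so at most
        \<open>?q\<close> indices are missed. As \<open>m \<le> 2 * ?q\<close> and there are at
        least \<open>2000 * ?q\<close> cycles, enough remain.\<close>
      define Z where "Z = {v\<in>?V. \<forall>s\<in>S. \<not> E s v}"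
      have Zn: "Z \<subseteq> {..<n}" using Vn by (auto simp: Z_def)
      have Sn: "S \<subseteq> {..<n}" using S(1) Xn by blast
      have "real (card S) * real (card Z) \<le> ?q\<^sup>2"
        by (rule no_edges_card_bound[OF G n d Sn Zn]) (auto simp: Z_def)
      moreover have "?q * real (card Z) \<le> real (card S) * real (card Z)"
        using m(1) S(2) by (intro mult_right_mono) auto
      ultimately have "?q * real (card Z) \<le> ?q * ?q" by (simp add: power2_eq_square)
      hence Zq: "real (card Z) \<le> ?q" using q by (subst (asm) mult_le_cancel_left_pos) linarith+
      have "card ({..<length Cs} - ?N S) \<le> card Z"
      proof (rule card_inj_on_le)
        show "inj_on (\<lambda>i. port Cs js i True) ({..<length Cs} - ?N S)"
          by (intro inj_onI) (use port_eqD in auto)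
        show "(\<lambda>i. port Cs js i True) ` ({..<length Cs} - ?N S) \<subseteq> Z"
          using portV by (auto simp: Z_def)
        show "finite Z" using fV by (simp add: Z_def)
      qed
      moreover have "card ({..<length Cs} - ?N S) = length Cs - card (?N S)"
        by (subst card_Diff_subset) auto
      ultimately have "real (length Cs) \<le> real (card (?N S)) + ?q" using Zq by linarith
      hence "real (4 * m + length Cs div 2) < real (card (?N S))"
        using mq l q by simp
      thus ?thesis by (simp only: of_nat_less_iff)
    qed
    show "\<exists>s\<in>S. \<exists>t\<in>T. E s t" if ST: "S \<subseteq> ?X" "T \<subseteq> ?X" "m \<le> card S" "m \<le> card T" for S T
    proof (rule ccontr)
      assume "\<not> ?thesis"
      hence "real (card S) * real (card T) \<le> ?q\<^sup>2"
        using ST Xn by (intro no_edges_card_bound[OF G n d]) blast+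
      moreover have "?q * ?q < real m * real m" using m(1) q by (intro mult_strict_mono) auto
      moreover have "real m * real m \<le> real (card S) * real (card T)"
        using ST by (intro mult_mono) auto
      ultimately show False by (simp add: power2_eq_square)
    qed
  qed (use E_sym port_eqD in blast)+
qed

theorem theorem7p2:
  "\<exists>n0::nat. \<forall>n d (lam::real) E (l::nat) Ps Cs.
     n \<ge> n0 \<longrightarrow> ndl_graph n d lam E \<longrightarrow> lam < real d / 500 \<longrightarrow>
     real l \<ge> 2000 * lam * real n / real d \<longrightarrow>
     good_collection n E (real l / (100 * ln (real n))) l (500 * lam) Ps Cs \<longrightarrow>
     (\<exists>hs. hamilton_cycle n (union_graph E Ps Cs) hs)"
\<comment> \<open>The threshold 3 leaves room for a cycle and ensures \<open>ln n \<ge> 1\<close>,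
  as used in \<open>chain_length_bound\<close>.\<close>
proof (intro exI[of _ 3] allI impI)
  fix n d :: nat and lam :: real and E :: "nat \<Rightarrow> nat \<Rightarrow> bool" and l :: nat and Ps Cs :: "nat list list"
  assume n: "3 \<le> n" and G: "ndl_graph n d lam E" and lam_d: "lam < real d / 500"
    and l: "2000 * lam * real n / real d \<le> real l"
    and good: "good_collection n E (real l / (100 * ln (real n))) l (500 * lam) Ps Cs"
  have n2: "n \<ge> 2" using n by simp
  have "lam \<ge> 0" by (rule ndl_graph_operator_bound(1)[OF G n2])
  hence d: "d > 0" using lam_d by (cases d) auto
  let ?q = "lam * real n / real d"
  have E: "E u v = E v u" "\<not> E u u" for u v using G by (auto simp: ndl_graph_def graph_on_def)
  \<comment> \<open>A vertex is not adjacent to itself, so the edge-free pair \<open>{0}\<close>,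
    \<open>{0}\<close> already forces \<open>?q \<ge> 1\<close>, and with it
    \<open>lam > 0\<close>.\<close>
  have "real (card {0::nat}) * real (card {0::nat}) \<le> ?q\<^sup>2"
    by (rule no_edges_card_bound[OF G n2 d]) (use n E in auto)
  hence q: "?q \<ge> 1" using \<open>lam \<ge> 0\<close> by (simp add: abs_le_square_iff[of 1, simplified, symmetric])
  have lq: "real l \<ge> 2000 * ?q" using l by simp
  from good[unfolded good_collection_def]
  obtain js where Ps: "Ps \<noteq> []" "\<forall>P\<in>set Ps. is_path n P" "pairwise_disjoint_lists Ps"
    and Cs: "\<forall>C\<in>set Cs. is_cycle n C" "pairwise_disjoint_lists Cs"
      "\<forall>C\<in>set Cs. \<forall>P\<in>set (tl Ps). set C \<inter> set P = {}"
    and cover: "(\<Union>P\<in>set Ps. set P) \<union> (\<Union>C\<in>set Cs. set C) = {0..<n}"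
    and js: "connects_via (hd Ps) Cs js"
    and len: "length Cs = l" and r: "real (length Ps) \<le> real l / (100 * ln (real n))"
    and deg1: "\<forall>v\<in>flex_set Cs js. real (card {u \<in> flex_set Cs js. E v u}) \<ge> 500 * lam"
    and deg2: "\<forall>P\<in>set Ps. \<forall>v\<in>{hd P, last P}. real (card {u \<in> flex_set Cs js. E v u}) \<ge> 500 * lam"
    by (elim conjE exE) (rule that; assumption)
  have deg: "real (card {u \<in> flex_set Cs js. E v u}) \<ge> 500 * lam"
    if "v \<in> flex_set Cs js \<union> hd ` set Ps \<union> last ` set Ps" for v
    using that deg1 deg2 by blast
  have cc: "connected_cycles n E Ps Cs js"
  proof
    show "E v u" if "E u v" for u v using that E(1)[of u v] by simp
  qed (use Ps Cs cover js in blast)+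
  interpret connected_cycles n E Ps Cs js by (rule cc)
  \<comment> \<open>The least integer strictly above \<open>?q\<close>: strictness is what forces an
    edge between any two sets of \<open>m\<close> vertices.\<close>
  define m where "m = nat \<lfloor>?q\<rfloor> + 1"
  have m: "real m > ?q" "real m \<le> ?q + 1"
  proof -
    have "real m = real_of_int \<lfloor>?q\<rfloor> + 1" using q by (simp add: m_def)
    thus "real m > ?q" "real m \<le> ?q + 1" using floor_correct[of ?q] by linarith+
  qed
  interpret port_expander E "port Cs js" "flex_set Cs js \<union> hd ` set Ps \<union> last ` set Ps" "length Cs" m "length Cs div 2"
    by (rule port_expander_of_flexible_ports[OF G n2 d cc q _ m deg]) (use lq len in auto)
  obtain k where k: "m \<le> 2 ^ k" "2 ^ k < 2 * m" using exists_power_two_between[OF m_pos] .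
  \<comment> \<open>The rotation pairs the end of each path with the start of the cyclically next
    one.\<close>
  define prs where "prs = zip (map last Ps) (map hd (rotate1 Ps))"
  have prs: "length prs = length Ps" "map fst prs = map last Ps" "map snd prs = rotate1 (map hd Ps)"
    by (auto simp: prs_def rotate1_map)
  have Pne: "P \<noteq> []" if "P \<in> set Ps" for P using paths[OF that] by (simp add: is_path_def)
  have "distinct (map f Ps)" if f: "\<And>P. P \<in> set Ps \<Longrightarrow> f P \<in> set P" for f
    unfolding distinct_conv_nth
  proof (intro allI impI)
    fix i j assume ij: "i < length (map f Ps)" "j < length (map f Ps)" "i \<noteq> j"
    have "set (Ps ! i) \<inter> set (Ps ! j) = {}"
      using paths_disj ij by (simp add: pairwise_disjoint_lists_def)
    thus "map f Ps ! i \<noteq> map f Ps ! j" using f[of "Ps ! i"] f[of "Ps ! j"] ij by auto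
  qed
  hence dist: "distinct (map last Ps)" "distinct (map hd Ps)" using Pne by auto
  have "\<exists>qss. length qss = length prs \<and>
    (\<forall>a<length prs. linked E (port Cs js) (fst (prs ! a)) (qss ! a) (snd (prs ! a))) \<and>
    distinct (map fst (concat qss)) \<and> fst ` set (concat qss) \<subseteq> {..<length Cs} - {}"
  proof (rule link_pairs[OF extendable_empty _ _ _ k(1)])
    show "parent_closed {} undefined" by (simp add: parent_closed_def)
    fix v
    show "v \<in> flex_set Cs js \<union> hd ` set Ps \<union> last ` set Ps \<and> (\<forall>i<length Cs. \<forall>b. v \<noteq> port Cs js i b)"
      if v: "v \<in> set (map fst prs) \<union> set (map snd prs)"
    proof -
      obtain P where P: "P \<in> set Ps" "v = hd P \<or> v = last P" using v by (auto simp: prs)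
      have "v \<in> set P" using P Pne by auto
      hence "v \<noteq> port Cs js i b" if "i < length Cs" for i b
        using path_rest_disj[OF P(1) that] port_in_rest[OF that] by auto
      thus ?thesis using P by auto
    qed
    have "count_list (map fst prs) v \<le> 1" "count_list (map snd prs) v \<le> 1"
      unfolding prs using dist by (intro count_list_le_1_if_distinct; simp)+
    thus "card {i\<in>{}. undefined i = v} + count_list (map fst prs) v + count_list (map snd prs) v \<le> 2"
      by simp
  next
    \<comment> \<open>Here \<open>lam < d / 500\<close> enters: it keeps \<open>m\<close> below
      \<open>n\<close>, so the depth of the trees is logarithmic in \<open>n\<close>.\<close>
    have "2 ^ k < 2 * n"
    proof -
      have "real m \<le> real n / 500 + 1"
      proof -
        have "?q \<le> (real d / 500) * real n / real d"
          using lam_d by (intro divide_right_mono mult_right_mono) auto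
        also have "\<dots> = real n / 500" using d by simp
        finally show ?thesis using m by linarith
      qed
      hence "real m \<le> real n" using n by simp
      hence "m \<le> n" by simp
      thus ?thesis using k(2) by linarith
    qed
    from chain_length_bound[OF this n] have kb: "2 * (real k + 1) \<le> 8 * ln (real n)" .
    have lnp: "ln (real n) > 0" using n by simp
    \<comment> \<open>The budget: \<open>l / (100 ln n)\<close> links at \<open>8 ln n\<close>
      indices each use \<open>8 l / 100\<close>, and the temporary trees use at most
      \<open>8 * (?q + 1) \<le> l / 100\<close>. Together this stays below
      \<open>l div 2\<close>.\<close>
    have "real (length Ps) * (2 * (real k + 1)) \<le> real l / (100 * ln (real n)) * (8 * ln (real n))"
      using lnp by (intro mult_mono r kb) auto
    also have "\<dots> = 8 / 100 * real l" using lnp by simp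
    finally have a: "25 * (real (length Ps) * (2 * (real k + 1))) \<le> 2 * real l" by simp
    have "real (2 ^ k) < 2 * real m" using k(2) by (metis of_nat_less_iff of_nat_mult of_nat_numeral)
    hence b: "real (4 * 2 ^ k) \<le> 8 * (?q + 1)" using m by simp
    have c: "real l \<le> 2 * real (l div 2) + 1" by linarith
    have arith: "x + y \<le> z" if "25 * x \<le> 2 * L" "y \<le> 8 * (p + 1)" "L \<le> 2 * z + 1" "2000 * p \<le> L" "1 \<le> p"
      for x y z L p :: real
    proof -
      have "y \<le> L / 100" using that(2,4,5) by simp
      moreover have "L \<ge> 2000" using that(4,5) by simp
      ultimately show ?thesis using that(1,3) by simp
    qed
    have "real (length prs * (2 * (k + 1)) + 4 * 2 ^ k) = real (length Ps) * (2 * (real k + 1)) + real (4 * 2 ^ k)"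
      by (simp add: prs algebra_simps)
    also have "\<dots> \<le> real (l div 2)" by (rule arith[OF a b c lq q])
    finally have "length prs * (2 * (k + 1)) + 4 * 2 ^ k \<le> l div 2" by (simp only: of_nat_le_iff)
    thus "card {} + length prs * (2 * (k + 1)) + 4 * 2 ^ k \<le> length Cs div 2" by (simp add: len)
  qed
  then obtain qss where qss: "length qss = length prs"
    "\<forall>a<length prs. linked E (port Cs js) (fst (prs ! a)) (qss ! a) (snd (prs ! a))"
    "distinct (map fst (concat qss))" "fst ` set (concat qss) \<subseteq> {..<length Cs}" by auto
  show "\<exists>hs. hamilton_cycle n (union_graph E Ps Cs) hs"
  proof (rule hamilton_cycle_of_links[OF n _ _ qss(3,4)])
    show "length qss = length Ps" using qss(1) prs(1) by simp
    show "linked E (port Cs js) (last (Ps ! j)) (qss ! j) (hd (Ps ! (Suc j mod length Ps)))"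
      if j: "j < length Ps" for j
    proof -
      have "fst (prs ! j) = last (Ps ! j)" "snd (prs ! j) = hd (Ps ! (Suc j mod length Ps))"
        using j by (simp_all add: prs_def nth_rotate1)
      thus ?thesis using qss(2) j prs(1) by metis
    qed
  qed
qed

end
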